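(* Let $n \geq 2$ and let $q$ be a prime power with $(n,q) \notin \{(2,2),(2,3)\}$, so that $N = L_n(q) = PSL_n(q)$ is a simple group. Put $v = \frac{q^n-1}{q-1}$ and identify a set $X$ of size $v$ with the point set of the projective space $PG(n-1,q)$, on which $N$ acts in its natural way. Let $G$ be a group with $N \leq G \leq \mathrm{Aut}(N)$ acting on $X$ extending this natural action of $N$, and let $\mathcal{D}$ be a non-trivial Steiner quadruple system $\mathrm{SQS}(v)$ with point set $X$. Then $G \leq \mathrm{Aut}(\mathcal{D})$ (i.e. $G$ acts on $\mathcal{D}$ as a group of automorphisms) if and only if, up to isomorphism, $n=2$ and $(\mathcal{D},G)$ is one of the following: (1) $q = 3^d$, the points of $\mathcal{D}$ are the elements of the projective line $\mathbb{F}_{3^d} \cup \{\infty\}$, the blocks are the images of $\mathbb{F}_3 \cup \{\infty\}$ under $PGL_2(3^d)$ with $d \geq 2$ (respectively under $L_2(3^d)$ with $d>1$ odd), and $L_2(3^d) \leq G \leq P\Gamma L_2(3^d)$; (2) $q \equiv 7 \pmod{12}$, the points are the elements of $\mathbb{F}_q \cup \{\infty\}$, the blocks are the images of $\{0,1,\infty,\varepsilon\}$ under $L_2(q)$, where $\varepsilon$ is a primitive sixth root of unity in $\mathbb{F}_q$, and $L_2(q) \leq G \leq P\Sigma L_2(q)$; (3) $q = 3^{2d}$ with $d \geq 1$, the points are the elements of $\mathbb{F}_{3^{2d}} \cup \{\infty\}$, the blocks are the (disjoint) union of the images of $\{0,1,-1,\infty\}$ and of $\{0,1,a,\infty\}$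 under $L_2(3^{2d})$, where $a$ is a non-square in $\mathbb{F}_{3^{2d}}^*$, and $L_2(3^{2d}) \leq G \leq P\Sigma L_2(3^{2d})$. In particular, for $n>2$, $G$ cannot act as a group of automorphisms on any $\mathrm{SQS}(v)$.
   Context: A Steiner quadruple system $\mathrm{SQS}(v)$ is a $3$-$(v,4,1)$ design: a set $X$ of $v$ points together with a family of $4$-subsets (blocks) such that every $3$-subset of $X$ is contained in exactly one block. It is trivial if $v=4$. An automorphism is a permutation of the points mapping blocks to blocks. $L_2(q)$, $PGL_2(q)$, $P\Sigma L_2(q) = L_2(q) \rtimes \mathrm{Gal}(\mathbb{F}_q)$ and $P\Gamma L_2(q)$ act on the projective line $\mathbb{F}_q \cup \{\infty\}$ by (semi)linear fractional transformations. *)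

theory Defs
  imports
    "HOL-Analysis.Determinants"
    "HOL-Algebra.Bij"
    "HOL-Algebra.Coset"
    "HOL-Algebra.Group_Action"
begin

definition steiner_quadruple_system :: "nat \<Rightarrow> 'p set \<Rightarrow> 'p set set \<Rightarrow> bool" where
  "steiner_quadruple_system v X \<B> \<longleftrightarrow>
     finite X \<and> card X = v \<and>
     (\<forall>b\<in>\<B>. b \<subseteq> X \<and> card b = 4) \<and>
     (\<forall>T. T \<subseteq> X \<and> card T = 3 \<longrightarrow> (\<exists>!b. b \<in> \<B> \<and> T \<subseteq> b))"

definition nontrivial_sqs :: "nat \<Rightarrow> 'p set \<Rightarrow> 'p set set \<Rightarrow> bool" where
  "nontrivial_sqs v X \<B> \<longleftrightarrow> steiner_quadruple_system v X \<B> \<and> v \<noteq> 4"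

definition design_automorphisms :: "'p set \<Rightarrow> 'p set set \<Rightarrow> ('p \<Rightarrow> 'p) set" where
  "design_automorphisms X \<B> = {g \<in> Bij X. \<forall>b\<in>\<B>. g ` b \<in> \<B>}"

text \<open>An isomorphism of pairs (design, permutation group) is a bijection of the point
  sets that carries blocks onto blocks and conjugates one permutation group onto the
  other.\<close>

definition design_group_isomorphic ::
  "'p set \<Rightarrow> 'p set set \<Rightarrow> ('p \<Rightarrow> 'p) set \<Rightarrow> 'r set \<Rightarrow> 'r set set \<Rightarrow> ('r \<Rightarrow> 'r) set \<Rightarrow> bool" where
  "design_group_isomorphic X \<B> H Y \<C> K \<longleftrightarrow>
     (\<exists>f. bij_betw f X Y \<and> (\<lambda>b. f ` b) ` \<B> = \<C> \<and>
          (\<lambda>h. \<lambda>y\<in>Y. f (h (inv_into X f y))) ` H = K)"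

definition inner_automorphism :: "('g, 'm) monoid_scheme \<Rightarrow> 'g \<Rightarrow> 'g \<Rightarrow> 'g" where
  "inner_automorphism N g = (\<lambda>x\<in>carrier N. g \<otimes>\<^bsub>N\<^esub> x \<otimes>\<^bsub>N\<^esub> inv\<^bsub>N\<^esub> g)"

definition SL :: "('a::field ^ 'n ^ 'n) monoid" where
  "SL = \<lparr>carrier = {A. det A = 1}, monoid.mult = (**), one = mat 1\<rparr>"

definition SL_scalars :: "('a::field ^ 'n ^ 'n) set" where
  "SL_scalars = {A \<in> carrier SL. \<exists>c. A = mat c}"

definition PSL :: "('a::field ^ 'n ^ 'n) set monoid" where
  "PSL = SL Mod SL_scalars"

definition pg_points :: "('a::field ^ 'n) set set" where
  "pg_points = {P. vec.subspace P \<and> vec.dim P = 1}"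

definition pg_action :: "'a::field ^ 'n ^ 'n \<Rightarrow> ('a ^ 'n) set \<Rightarrow> ('a ^ 'n) set" where
  "pg_action A = (\<lambda>P\<in>pg_points. (\<lambda>x. A *v x) ` P)"

text \<open>The projective line over the field is modelled by the option type, with None as the
  point at infinity. The groups of (semi)linear fractional transformations of the line are
  given as sets of permutations of it.\<close>

definition moebius :: "'a::field \<Rightarrow> 'a \<Rightarrow> 'a \<Rightarrow> 'a \<Rightarrow> 'a option \<Rightarrow> 'a option" where
  "moebius a b c d z =
     (case z of
        None \<Rightarrow> if c = 0 then None else Some (a / c)
      | Some x \<Rightarrow> if c * x + d = 0 then None else Some ((a * x + b) / (c * x + d)))"

definition field_automorphism :: "('a::field \<Rightarrow> 'a) \<Rightarrow> bool" where
  "field_automorphism \<sigma> \<longleftrightarrow>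
     bij \<sigma> \<and> \<sigma> 1 = 1 \<and> (\<forall>x y. \<sigma> (x + y) = \<sigma> x + \<sigma> y) \<and> (\<forall>x y. \<sigma> (x * y) = \<sigma> x * \<sigma> y)"

definition L2_line :: "('a::field option \<Rightarrow> 'a option) set" where
  "L2_line = {moebius a b c d | a b c d. a * d - b * c = 1}"

definition PGL2_line :: "('a::field option \<Rightarrow> 'a option) set" where
  "PGL2_line = {moebius a b c d | a b c d. a * d - b * c \<noteq> 0}"

definition PSigmaL2_line :: "('a::field option \<Rightarrow> 'a option) set" where
  "PSigmaL2_line = {g \<circ> map_option \<sigma> | g \<sigma>. g \<in> L2_line \<and> field_automorphism \<sigma>}"

definition PGammaL2_line :: "('a::field option \<Rightarrow> 'a option) set" where
  "PGammaL2_line = {g \<circ> map_option \<sigma> | g \<sigma>. g \<in> PGL2_line \<and> field_automorphism \<sigma>}"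

definition images_under :: "('p \<Rightarrow> 'p) set \<Rightarrow> 'p set \<Rightarrow> 'p set set" where
  "images_under H S = {h ` S | h. h \<in> H}"

definition prime_subfield :: "'a::{field,finite} set" where
  "prime_subfield = range of_int"

definition primitive_root_of_unity :: "nat \<Rightarrow> 'a::field \<Rightarrow> bool" where
  "primitive_root_of_unity k z \<longleftrightarrow> z ^ k = 1 \<and> (\<forall>j. 0 < j \<and> j < k \<longrightarrow> z ^ j \<noteq> 1)"

end

theory Submission
  imports Defs
begin

text \<open>
  A block through three points contains a fourth point, which is fixed by every automorphism
  stabilising the triple.

  For \<open>n > 2\<close> this is contradictory: over a field with an element \<open>t \<noteq> 0, 1\<close> the diagonal matrices
  and transvections of \<open>SL\<^sub>n\<close> fixing three coordinate points fix no further point that is not a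
  coordinate point, and move every other coordinate point; over the field with two elements the
  transvections fixing the three points of a line move every point off that line.

  For \<open>n = 2\<close> the fourth point \<open>e\<close> of the block through \<open>0, 1, \<infinity>\<close> is fixed by \<open>x \<mapsto> 1 / (1 - x)\<close>, so
  \<open>e\<^sup>2 - e + 1 = 0\<close>. If \<open>-1\<close> is a square, \<open>x \<mapsto> 1 - x\<close> fixes \<open>e\<close> as well and the characteristic is 3.
  In characteristic 3 we get \<open>e = -1\<close>, also for all translates of the system by \<open>PGL\<^sub>2\<close>, which
  determines it. Otherwise \<open>-1\<close> is a nonsquare, \<open>e\<close> is a primitive sixth root of unity, and \<open>L\<^sub>2\<close> is
  transitive on triples. The group acts by permutations normalising \<open>L\<^sub>2\<close>; after multiplication by
  an element of \<open>PGL\<^sub>2\<close> such a permutation fixes \<open>0, 1, \<infinity>\<close>, and compatibility with the translations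
  and the dilations by squares makes it a field automorphism. Hence the group lies in \<open>P\<Gamma>L\<^sub>2\<close>.
\<close>

section \<open>Finite fields\<close>

text \<open>Multiplication by \<open>x\<close> permutes the nonzero elements, so their product
  equals a power of \<open>x\<close> times itself and can be cancelled.\<close>

lemma finite_field_fermat:
  fixes x :: "'a::{field,finite}"
  assumes "x \<noteq> 0"
  shows "x ^ (CARD('a) - 1) = 1"
proof -
  let ?U = "UNIV - {0::'a}"
  have inj: "inj_on ((*) x) ?U"
    using assms by (auto simp: inj_on_def)
  have "(\<Prod>y\<in>?U. y) = (\<Prod>y\<in>(*) x ` ?U. y)"
    using assms by (intro arg_cong[where f = "prod (\<lambda>y. y)"] endo_inj_surj[symmetric]) (auto simp: inj)
  also have "\<dots> = (\<Prod>y\<in>?U. x * y)"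
    using inj by (simp add: prod.reindex)
  also have "\<dots> = x ^ card ?U * (\<Prod>y\<in>?U. y)"
    by (simp add: prod.distrib)
  finally have "x ^ card ?U = 1"
    by simp
  then show ?thesis
    by (simp add: card_Diff_singleton)
qed

text \<open>An involution without fixed points splits \<open>A\<close> into two-element orbits. This
  serves the parity arguments and the count of squares.\<close>

lemma card_involution_orbits:
  assumes "finite A" "\<And>x. x \<in> A \<Longrightarrow> h x \<in> A" "\<And>x. x \<in> A \<Longrightarrow> h (h x) = x"
    "\<And>x. x \<in> A \<Longrightarrow> h x \<noteq> x"
  shows "2 * card ((\<lambda>y. {y, h y}) ` A) = card A"
proof -
  let ?P = "(\<lambda>y. {y, h y}) ` A"
  have "2 * card ?P = card (\<Union>?P)"
  proof (rule card_partition)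
    show "finite ?P" "finite (\<Union>?P)" using assms(1) by auto
    show "card c = 2" if "c \<in> ?P" for c
      using that assms(4) by (force simp: card_2_iff)
    show "c1 \<inter> c2 = {}" if "c1 \<in> ?P" "c2 \<in> ?P" "c1 \<noteq> c2" for c1 c2
    proof -
      obtain x y where xy: "x \<in> A" "y \<in> A" "c1 = {x, h x}" "c2 = {y, h y}"
        using \<open>c1 \<in> ?P\<close> \<open>c2 \<in> ?P\<close> by blast
      \<comment> \<open>Any common element would make the two orbits equal, since \<open>h\<close>
        is an involution.\<close>
      have "x \<noteq> y" "x \<noteq> h y" "h x \<noteq> y" "h x \<noteq> h y"
        using \<open>c1 \<noteq> c2\<close> xy assms(3)[OF xy(1)] assms(3)[OF xy(2)] by (metis insert_commute)+
      then show ?thesis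
        using xy by simp
    qed
  qed
  moreover have "\<Union>?P = A" using assms(2) by auto
  ultimately show ?thesis by simp
qed

lemma involution_even_card:
  assumes "finite A" "\<And>x. x \<in> A \<Longrightarrow> h x \<in> A" "\<And>x. x \<in> A \<Longrightarrow> h (h x) = x"
    "\<And>x. x \<in> A \<Longrightarrow> h x \<noteq> x"
  shows "even (card A)"
  using card_involution_orbits[of A h] assms by (metis dvd_triv_left)

section \<open>Squares and the order of the field modulo 4\<close>

lemma mod_4_imp_minus_one_nonsquare:
  assumes "CARD('a::{field,finite}) mod 4 = 3"
  shows "x\<^sup>2 \<noteq> (-1::'a)"
proof
  assume x: "x\<^sup>2 = -1"
  then have "x \<noteq> 0" by auto
  define k where "k = CARD('a) div 4"
  \<comment> \<open>Half of q - 1 is odd, so the power of \<open>x\<close> with exponent q - 1 is an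
    odd power of -1.\<close>
  have "CARD('a) - 1 = 2 * (2 * k + 1)"
    using assms unfolding k_def by presburger
  then have "x ^ (CARD('a) - 1) = (x\<^sup>2) ^ (2 * k + 1)"
    by (simp only: power_mult)
  also have "\<dots> = -1"
    by (simp add: x)
  finally have two: "(1::'a) = -1"
    using finite_field_fermat[OF \<open>x \<noteq> 0\<close>] by simp
  \<comment> \<open>If 1 = -1, translation by 1 is an involution without fixed points, which would
    make the order even.\<close>
  have "y + 1 + 1 = y" for y :: 'a
    using two by (metis add.assoc add.right_inverse add_0_right)
  then have "even (card (UNIV::'a set))"
    by (intro involution_even_card[where h = "\<lambda>y. y + 1"]) auto
  then show False
    using assms by presburger
qed

text \<open>Squaring is two-to-one on the nonzero elements. A square that is also the negative of a
  square would give a root of -1, so squares and their negatives are disjoint and fill the nonzero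
  elements by counting.\<close>

lemma card_nonzero_squares:
  assumes "\<forall>x. x\<^sup>2 \<noteq> (-1::'a::{field,finite})"
  defines "S \<equiv> (\<lambda>x::'a. x\<^sup>2) ` (UNIV - {0})"
  shows "CARD('a) = 2 * card S + 1" and "S \<union> uminus ` S = UNIV - {0}"
proof -
  have one: "(1::'a) \<noteq> -1"
    using assms(1) by (metis one_power2)
  have ne: "- x \<noteq> x" if "x \<noteq> 0" for x :: 'a
  proof
    assume "- x = x"
    then have "(-1) * x = 1 * x" by simp
    then have "(-1::'a) = 1" using mult_right_cancel[OF that] by blast
    then show False using one by simp
  qed
  have "2 * card ((\<lambda>x::'a. {x, -x}) ` (UNIV - {0})) = card (UNIV - {0::'a})"
    by (rule card_involution_orbits) (use ne in auto)
  moreover have "card ((\<lambda>x::'a. {x, -x}) ` (UNIV - {0})) = card S"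
  proof -
    have *: "{y. y\<^sup>2 = x\<^sup>2} = {x, - x}" for x :: 'a
      by (auto simp: power2_eq_iff)
    have "(\<lambda>x::'a. {x, -x}) ` (UNIV - {0}) = (\<lambda>s. {y. y\<^sup>2 = s}) ` S"
      unfolding S_def image_image * ..
    moreover have "inj_on (\<lambda>s. {y. y\<^sup>2 = s}) S"
      unfolding S_def inj_on_def by blast
    ultimately show ?thesis
      by (metis card_image)
  qed
  moreover have "card (UNIV - {0::'a}) = CARD('a) - 1"
    by (simp add: card_Diff_singleton)
  ultimately have "2 * card S = CARD('a) - 1" by simp
  then show c: "CARD('a) = 2 * card S + 1"
    using zero_less_card_finite[where 'a = 'a] by linarith
  have disj: "S \<inter> uminus ` S = {}"
  proof (rule ccontr)
    assume "S \<inter> uminus ` S \<noteq> {}"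
    then obtain x y :: 'a where "x \<noteq> 0" "y \<noteq> 0" "x\<^sup>2 = - (y\<^sup>2)" unfolding S_def by auto
    then have "(x / y)\<^sup>2 = -1" by (simp add: power_divide)
    then show False using assms(1) by blast
  qed
  have "card (S \<union> uminus ` S) = card S + card (uminus ` S)"
    using disj by (intro card_Un_disjoint) auto
  also have "\<dots> = card (UNIV - {0::'a})"
    using c by (simp add: card_image card_Diff_singleton)
  finally show "S \<union> uminus ` S = UNIV - {0}"
    by (intro card_subset_eq) (auto simp: S_def)
qed

lemma square_or_minus_square:
  fixes x :: "'a::{field,finite}"
  assumes "\<forall>x. x\<^sup>2 \<noteq> (-1::'a)"
  obtains u where "x = u\<^sup>2 \<or> x = - (u\<^sup>2)"
proof (cases "x = 0")
  case True
  then show ?thesis using that[of 0] by simp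
next
  case False
  then have "x \<in> (\<lambda>x::'a. x\<^sup>2) ` (UNIV - {0}) \<union> uminus ` (\<lambda>x::'a. x\<^sup>2) ` (UNIV - {0})"
    using card_nonzero_squares(2)[OF assms] by simp
  then show ?thesis using that by auto
qed

text \<open>Inversion acts on the nonzero squares other than 1. A fixed point would be -1, which is
  no square, so the number of nonzero squares is odd.\<close>

lemma minus_one_nonsquare_imp_mod_4:
  assumes "\<forall>x. x\<^sup>2 \<noteq> (-1::'a::{field,finite})"
  shows "CARD('a) mod 4 = 3"
proof -
  define S where "S = (\<lambda>x::'a. x\<^sup>2) ` (UNIV - {0})"
  have "even (card (S - {1}))"
  proof (rule involution_even_card)
    fix x assume x: "x \<in> S - {1}"
    then have x0: "x \<noteq> 0" "x \<noteq> 1" "x \<noteq> -1"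
      using assms by (auto simp: S_def)
    from x obtain y where "y \<noteq> 0" "x = y\<^sup>2" by (auto simp: S_def)
    then show "inverse x \<in> S - {1}"
      using x0 by (auto simp: S_def power_inverse intro!: image_eqI[of _ _ "inverse y"])
    show "inverse x \<noteq> x"
    proof
      assume "inverse x = x"
      then have "x\<^sup>2 = 1" using x0 by (metis power2_eq_square right_inverse)
      then show False using x0 by (simp add: power2_eq_1_iff)
    qed
  qed simp_all
  moreover have "1 \<in> S" by (auto simp: S_def intro!: image_eqI[of _ _ 1])
  then have "card S = Suc (card (S - {1}))"
    using card.remove[of S 1] by simp
  ultimately have "odd (card S)"
    by simp
  then show ?thesis
    using card_nonzero_squares(1)[OF assms] unfolding S_def by presburger
qed

section \<open>Characteristic 3 and fields of order a power of 3\<close>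

lemma char_3_imp_card_power:
  assumes three: "(3::'a::{field,finite}) = 0"
  obtains d where "CARD('a) = 3 ^ d"
proof -
  \<comment> \<open>These are the additive subgroups of 3-power order: negatives come for free
    because -x = x + x.\<close>
  define Q where "Q H \<longleftrightarrow> 0 \<in> H \<and> (\<forall>x\<in>H. \<forall>y\<in>H. x + y \<in> H) \<and> (\<exists>d. card H = 3 ^ d)" for H :: "'a set"
  have neg: "- x = x + x" for x :: 'a
  proof -
    have "x + x + x = 3 * x"
      by simp
    then show ?thesis
      using three by (simp add: eq_neg_iff_add_eq_0 neg_eq_iff_add_eq_0 add.assoc)
  qed
  have "Q {0}" by (auto simp: Q_def intro: exI[of _ 0])
  then obtain H where H: "Q H" and mx: "\<And>H'. Q H' \<Longrightarrow> card H' \<le> card H"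
    using ex_has_greatest_nat[of Q "{0}" card "CARD('a) + 1"] card_mono[of "UNIV::'a set"]
    by (auto simp: less_Suc_eq_le)
  have clo: "x + y \<in> H" if "x \<in> H" "y \<in> H" for x y using H that by (auto simp: Q_def)
  have nclo: "- x \<in> H" if "x \<in> H" for x using clo[OF that that] neg[of x] by argo
  have dclo: "x - y \<in> H" if "x \<in> H" "y \<in> H" for x y using clo nclo that by (metis diff_conv_add_uminus)
  have "H = UNIV"
  proof (rule ccontr)
    assume "H \<noteq> UNIV"
    then obtain x where x: "x \<notin> H" by auto
    \<comment> \<open>The cosets of \<open>H\<close> through 0, \<open>x\<close> and
      \<open>-x\<close> are disjoint and together form a subgroup of three times the order, against
      the maximality of \<open>H\<close>.\<close>
    define H' where "H' = H \<union> (+) x ` H \<union> (+) (- x) ` H"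
    have x2: "- x \<notin> H" using x nclo by fastforce
    have d1: "H \<inter> (+) x ` H = {}" using x dclo[of "x + a" a for a] by fastforce
    have d2: "H \<inter> (+) (-x) ` H = {}" using x2 dclo[of "-x + a" a for a] by fastforce
    have d3: "(+) x ` H \<inter> (+) (-x) ` H = {}"
    proof (rule ccontr)
      assume "(+) x ` H \<inter> (+) (-x) ` H \<noteq> {}"
      then obtain y where "y \<in> (+) x ` H" "y \<in> (+) (-x) ` H" by blast
      then obtain a b where "a \<in> H" "b \<in> H" "x + a = - x + b" by (metis imageE)
      then have "x + x = b - a" by (simp add: algebra_simps eq_diff_eq)
      then show False using x2 dclo \<open>a \<in> H\<close> \<open>b \<in> H\<close> neg by metis
    qed
    have "card H' = card H + card ((+) x ` H) + card ((+) (-x) ` H)"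
      unfolding H'_def using d1 d2 d3 by (subst card_Un_disjoint; (subst card_Un_disjoint)?) auto
    then have c: "card H' = 3 * card H"
      by (simp add: card_image)
    have sums: "x + x = - x" "- x + - x = x" using neg[of x] neg[of "-x"] by auto
    have "Q H'"
      unfolding Q_def
    proof (intro conjI ballI)
      show "0 \<in> H'" using H by (auto simp: H'_def Q_def)
      show "\<exists>d. card H' = 3 ^ d" using H c by (metis Q_def power_Suc)
      fix u w assume "u \<in> H'" "w \<in> H'"
      then obtain s t a b where st: "s \<in> {0, x, -x}" "t \<in> {0, x, -x}" "a \<in> H" "b \<in> H" "u = s + a" "w = t + b"
        unfolding H'_def by fastforce
      then have "s + t \<in> {0, x, -x}" using sums by auto
      moreover have "u + w = (s + t) + (a + b)" using st by (simp add: algebra_simps)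
      ultimately show "u + w \<in> H'" using clo[OF st(3,4)] unfolding H'_def by (auto intro: image_eqI)
    qed
    then have "3 * card H \<le> card H" using mx c by metis
    moreover have "card H > 0" using H by (auto simp: Q_def card_gt_0_iff)
    ultimately show False by simp
  qed
  then show ?thesis using H that by (auto simp: Q_def)
qed

text \<open>Translation by 1 permutes the terms of the sum over all elements, so q times 1 is zero.
  In a field a power of 3 vanishes only if 3 does.\<close>

lemma card_power_3_imp_char_3:
  assumes "CARD('a::{field,finite}) = 3 ^ d"
  shows "(3::'a) = 0"
proof -
  have "of_nat CARD('a) = (0::'a)"
  proof -
    have "(\<Sum>y\<in>UNIV. y) = (\<Sum>y\<in>(+) 1 ` UNIV. y::'a)"
      by (intro arg_cong[where f = "sum (\<lambda>y. y)"] endo_inj_surj[symmetric]) auto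
    also have "\<dots> = (\<Sum>y\<in>UNIV. 1 + (y::'a))"
      by (subst sum.reindex) auto
    finally show ?thesis by (simp add: sum.distrib)
  qed
  then have "(3::'a) ^ d = 0" using assms by simp
  then show ?thesis by simp
qed

section \<open>Linear fractional transformations\<close>

lemma moebius_simps [simp]:
  "moebius a b c d None = (if c = 0 then None else Some (a / c))"
  "moebius a b c d (Some x) = (if c * x + d = 0 then None else Some ((a * x + b) / (c * x + d)))"
  by (simp_all add: moebius_def)

lemma moebius_scale:
  assumes "k \<noteq> 0"
  shows "moebius (k * a) (k * b) (k * c) (k * d) = moebius a b c d"
proof
  fix z
  have "k * c * x + k * d = k * (c * x + d)" "k * a * x + k * b = k * (a * x + b)" for x
    by (simp_all add: algebra_simps)
  then show "moebius (k * a) (k * b) (k * c) (k * d) z = moebius a b c d z"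
    using assms by (cases z) simp_all
qed

text \<open>Composition is matrix multiplication. The determinant condition on the inner map
  excludes 0/0: its numerator and denominator cannot vanish together.\<close>

lemma moebius_comp:
  assumes "a' * d' - b' * c' \<noteq> 0"
  shows "moebius a b c d \<circ> moebius a' b' c' d' =
    moebius (a * a' + b * c') (a * b' + b * d') (c * a' + d * c') (c * b' + d * d')"
proof
  fix z
  show "(moebius a b c d \<circ> moebius a' b' c' d') z =
    moebius (a * a' + b * c') (a * b' + b * d') (c * a' + d * c') (c * b' + d * d') z"
  proof (cases z)
    case None
    show ?thesis
    proof (cases "c' = 0")
      case True
      then have "a' \<noteq> 0" using assms by auto
      then show ?thesis using True None by simp
    next
      case False
      then have "c * (a' / c') + d = (c * a' + d * c') / c'" "a * (a' / c') + b = (a * a' + b * c') / c'"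
        by (simp_all add: field_simps)
      then show ?thesis using False None by simp
    qed
  next
    case (Some x)
    have num: "(a * a' + b * c') * x + (a * b' + b * d') = a * (a' * x + b') + b * (c' * x + d')"
      and den: "(c * a' + d * c') * x + (c * b' + d * d') = c * (a' * x + b') + d * (c' * x + d')"
      by (simp_all add: algebra_simps)
    show ?thesis
    proof (cases "c' * x + d' = 0")
      case True
      have "a' * x + b' \<noteq> 0"
      proof
        assume *: "a' * x + b' = 0"
        have "a' * d' - b' * c' = a' * (c' * x + d') - c' * (a' * x + b')"
          by (simp add: algebra_simps)
        then show False using assms True * by simp
      qed
      then show ?thesis using True Some by (simp add: num den)
    next
      case False
      define p r where "p = a' * x + b'" and "r = c' * x + d'"
      have "r \<noteq> 0" using False r_def by simp
      then have "c * (p / r) + d = (c * p + d * r) / r" "a * (p / r) + b = (a * p + b * r) / r"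
        by (simp_all add: field_simps)
      then have "(moebius a b c d \<circ> moebius a' b' c' d') z =
          (if c * p + d * r = 0 then None else Some ((a * p + b * r) / (c * p + d * r)))"
        using \<open>r \<noteq> 0\<close> Some by (simp flip: p_def r_def)
      also have "\<dots> = moebius (a * a' + b * c') (a * b' + b * d') (c * a' + d * c') (c * b' + d * d') z"
        using Some by (simp add: num den flip: p_def r_def)
      finally show ?thesis .
    qed
  qed
qed

lemma moebius_id: "k \<noteq> 0 \<Longrightarrow> moebius k 0 0 k = id"
proof
  fix z
  assume "k \<noteq> 0"
  then show "moebius k 0 0 k z = id z"
    by (cases z) auto
qed

text \<open>The second map belongs to the adjugate matrix, and either product is the determinant
  times the identity matrix.\<close>

lemma moebius_inverse:
  assumes "a * d - b * c \<noteq> 0"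
  shows "moebius a b c d \<circ> moebius d (- b) (- c) a = id"
    and "moebius d (- b) (- c) a \<circ> moebius a b c d = id"
proof -
  have "d * a - (- b) * (- c) \<noteq> 0"
    using assms by (simp add: mult.commute)
  then have "moebius a b c d \<circ> moebius d (- b) (- c) a = moebius (a * d - b * c) 0 0 (a * d - b * c)"
    by (subst moebius_comp) (simp_all add: algebra_simps)
  then show "moebius a b c d \<circ> moebius d (- b) (- c) a = id"
    using moebius_id[OF assms] by simp
  have "moebius d (- b) (- c) a \<circ> moebius a b c d = moebius (a * d - b * c) 0 0 (a * d - b * c)"
    by (subst moebius_comp[OF assms]) (simp add: algebra_simps)
  then show "moebius d (- b) (- c) a \<circ> moebius a b c d = id"
    using moebius_id[OF assms] by simp
qed

lemma moebius_in_PGL2: "a * d - b * c \<noteq> 0 \<Longrightarrow> moebius a b c d \<in> PGL2_line"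
  by (auto simp: PGL2_line_def)

text \<open>Dividing all coefficients by \<open>k\<close> does not change the map and divides the
  determinant by k^2, so a nonzero square determinant is good enough.\<close>

lemma moebius_in_L2:
  assumes "a * d - b * c = k\<^sup>2" "k \<noteq> 0"
  shows "moebius a b c d \<in> L2_line"
proof -
  have "(a / k) * (d / k) - (b / k) * (c / k) = (a * d - b * c) / k\<^sup>2"
    by (simp add: power2_eq_square diff_divide_distrib)
  then have "(a / k) * (d / k) - (b / k) * (c / k) = 1"
    using assms by simp
  moreover have "moebius a b c d = moebius (a / k) (b / k) (c / k) (d / k)"
    using moebius_scale[of k "a / k" "b / k" "c / k" "d / k"] assms(2) by simp
  ultimately show ?thesis
    unfolding L2_line_def by blast
qed

lemma L2_subset_PGL2: "L2_line \<subseteq> PGL2_line"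
  unfolding L2_line_def PGL2_line_def by force

lemma id_in_L2: "id \<in> L2_line"
  using moebius_in_L2[of 1 1 0 0 1] moebius_id[of 1] by (metis diff_zero mult_1 mult_zero_left one_neq_zero one_power2)

lemma PGL2_comp:
  assumes "g \<in> PGL2_line" "h \<in> PGL2_line"
  shows "g \<circ> h \<in> PGL2_line"
proof -
  obtain a b c d a' b' c' d' where g: "g = moebius a b c d" "a * d - b * c \<noteq> 0"
    and h: "h = moebius a' b' c' d'" "a' * d' - b' * c' \<noteq> 0"
    using assms by (auto simp: PGL2_line_def)
  have "(a * a' + b * c') * (c * b' + d * d') - (a * b' + b * d') * (c * a' + d * c') =
      (a * d - b * c) * (a' * d' - b' * c')"
    by (simp add: algebra_simps)
  then show ?thesis
    using g h by (auto simp: moebius_comp intro!: moebius_in_PGL2)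
qed

lemma L2_comp:
  assumes "g \<in> L2_line" "h \<in> L2_line"
  shows "g \<circ> h \<in> L2_line"
proof -
  obtain a b c d a' b' c' d' where g: "g = moebius a b c d" "a * d - b * c = 1"
    and h: "h = moebius a' b' c' d'" "a' * d' - b' * c' = 1"
    using assms by (auto simp: L2_line_def)
  have "(a * a' + b * c') * (c * b' + d * d') - (a * b' + b * d') * (c * a' + d * c') =
      (a * d - b * c) * (a' * d' - b' * c')"
    by (simp add: algebra_simps)
  then show ?thesis
    using g h moebius_comp[of a' d' b' c' a b c d] unfolding L2_line_def by (auto intro!: exI)
qed

lemma PGL2_inverse:
  assumes "g \<in> PGL2_line"
  obtains g' where "g' \<in> PGL2_line" "g \<circ> g' = id" "g' \<circ> g = id"
proof -
  obtain a b c d where g: "g = moebius a b c d" "a * d - b * c \<noteq> 0"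
    using assms by (auto simp: PGL2_line_def)
  show ?thesis
    using g moebius_inverse[OF g(2)]
    by (intro that[of "moebius d (- b) (- c) a"]) (auto simp: mult.commute intro!: moebius_in_PGL2)
qed

lemma L2_inverse:
  assumes "g \<in> L2_line"
  obtains g' where "g' \<in> L2_line" "g \<circ> g' = id" "g' \<circ> g = id"
proof -
  obtain a b c d where g: "g = moebius a b c d" "a * d - b * c = 1"
    using assms by (auto simp: L2_line_def)
  show ?thesis
    using g moebius_inverse[of a d b c]
    by (intro that[of "moebius d (- b) (- c) a"])
      (auto simp: mult.commute intro!: moebius_in_L2[where k = 1])
qed

lemma PGL2_bij: "g \<in> PGL2_line \<Longrightarrow> bij g"
  by (metis PGL2_inverse o_bij)

text \<open>The product of the matrices of \<open>g\<close>, \<open>h\<close> and the adjugate of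
  \<open>g\<close> has determinant (det g)^2, a nonzero square.\<close>

lemma PGL2_conj_L2:
  assumes "g \<in> PGL2_line" "g \<circ> g' = id" "h \<in> L2_line"
  shows "g \<circ> h \<circ> g' \<in> L2_line"
proof -
  obtain a b c d a' b' c' d' where g: "g = moebius a b c d" "a * d - b * c \<noteq> 0"
    and h: "h = moebius a' b' c' d'" "a' * d' - b' * c' = 1"
    using assms by (auto simp: PGL2_line_def L2_line_def)
  \<comment> \<open>A right inverse of \<open>g\<close> coincides with its two-sided inverse, the
    adjugate map.\<close>
  have g': "g' = moebius d (- b) (- c) a"
    using moebius_inverse[OF g(2)] assms(2) unfolding g(1)[symmetric]
    by (metis comp_assoc fun.map_id id_comp)
  have d1: "d * a - (- b) * (- c) \<noteq> 0"
    using g(2) by (simp add: mult.commute)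
  let ?A = "a * a' + b * c'" and ?B = "a * b' + b * d'" and ?C = "c * a' + d * c'" and ?D = "c * b' + d * d'"
  have "g \<circ> h \<circ> g' = moebius (?A * d + ?B * - c) (?A * - b + ?B * a) (?C * d + ?D * - c) (?C * - b + ?D * a)"
    unfolding g' g(1) h(1) using h(2) by (subst moebius_comp, simp) (subst moebius_comp[OF d1], simp)
  moreover have "(?A * d + ?B * - c) * (?C * - b + ?D * a) - (?A * - b + ?B * a) * (?C * d + ?D * - c)
      = (?A * ?D - ?B * ?C) * (a * d - b * c)"
    by (simp add: algebra_simps)
  moreover have "?A * ?D - ?B * ?C = (a * d - b * c) * (a' * d' - b' * c')"
    by (simp add: algebra_simps)
  ultimately show ?thesis
    using g(2) h(2) by (auto simp: power2_eq_square intro!: moebius_in_L2[where k = "a * d - b * c"])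
qed

section \<open>Moving triples of points by \<open>PGL2_line\<close>\<close>

lemma PGL2_to_standard_triple:
  fixes p :: "'a::field option"
  assumes "p \<noteq> r" "p \<noteq> s" "r \<noteq> s"
  obtains g where "g \<in> PGL2_line" "g p = Some 0" "g r = Some 1" "g s = None"
proof -
  obtain g1 where g1: "g1 \<in> PGL2_line" "g1 s = None"
  proof (cases s)
    case None
    then show ?thesis using that[of id] id_in_L2 L2_subset_PGL2 by auto
  next
    case (Some x)
    \<comment> \<open>The map z -> 1 / (z - x) sends \<open>x\<close> to infinity.\<close>
    then show ?thesis
      using that[of "moebius 0 1 1 (- x)"] moebius_in_PGL2[of 0 "- x" 1 1] by simp
  qed
  have "g1 p \<noteq> None" "g1 r \<noteq> None" "g1 p \<noteq> g1 r"
    using PGL2_bij[OF g1(1)] assms g1(2) by (metis bij_pointE)+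
  then obtain x y where xy: "g1 p = Some x" "g1 r = Some y" "x \<noteq> y"
    by auto
  \<comment> \<open>The affine map z -> (z - x) / (y - x) fixes infinity and carries
    \<open>x\<close> and \<open>y\<close> to 0 and 1.\<close>
  have "moebius 1 (- x) 0 (y - x) \<in> PGL2_line"
    using xy by (intro moebius_in_PGL2) simp
  then have "moebius 1 (- x) 0 (y - x) \<circ> g1 \<in> PGL2_line"
    using g1(1) by (rule PGL2_comp)
  then show ?thesis
    using xy g1(2) by (intro that[of "moebius 1 (- x) 0 (y - x) \<circ> g1"]) auto
qed

lemma PGL2_from_standard_triple:
  fixes p :: "'a::field option"
  assumes "p \<noteq> r" "p \<noteq> s" "r \<noteq> s"
  obtains g where "g \<in> PGL2_line" "g (Some 0) = p" "g (Some 1) = r" "g None = s"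
proof -
  obtain g where g: "g \<in> PGL2_line" "g p = Some 0" "g r = Some 1" "g s = None"
    using PGL2_to_standard_triple[OF assms] by blast
  obtain g' where "g' \<in> PGL2_line" "g' \<circ> g = id"
    using PGL2_inverse[OF g(1)] by blast
  then show ?thesis
    using g that[of g'] by (metis comp_apply id_apply)
qed

text \<open>When -1 is not a square, each determinant is a square or the negative of one, so outside
  \<open>L2_line\<close> a factor of determinant -1 brings the map back into
  \<open>L2_line\<close>.\<close>

lemma PGL2_square_class:
  fixes g :: "'a::{field,finite} option \<Rightarrow> 'a option"
  assumes "\<forall>x. x\<^sup>2 \<noteq> (-1::'a)" "g \<in> PGL2_line" "g \<notin> L2_line"
    and t: "t = moebius a' b' c' d'" "a' * d' - b' * c' = -1"
  shows "g \<circ> t \<in> L2_line"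
proof -
  obtain a b c d where g: "g = moebius a b c d" "a * d - b * c \<noteq> 0"
    using assms by (auto simp: PGL2_line_def)
  obtain u where u: "a * d - b * c = u\<^sup>2 \<or> a * d - b * c = - (u\<^sup>2)"
    using square_or_minus_square[OF assms(1)] .
  then have u': "a * d - b * c = - (u\<^sup>2)" "u \<noteq> 0"
    using g moebius_in_L2[of a d b c u] assms(3) by auto
  have "(a * a' + b * c') * (c * b' + d * d') - (a * b' + b * d') * (c * a' + d * c') =
      (a * d - b * c) * (a' * d' - b' * c')"
    by (simp add: algebra_simps)
  then have "(a * a' + b * c') * (c * b' + d * d') - (a * b' + b * d') * (c * a' + d * c') = u\<^sup>2"
    using t u' by simp
  then show ?thesis
    using g t u'(2) by (auto simp: moebius_comp intro!: moebius_in_L2[where k = u])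
qed

section \<open>Field automorphisms acting on the projective line\<close>

lemma map_option_moebius:
  assumes "field_automorphism \<sigma>"
  shows "map_option \<sigma> (moebius a b c d z) = moebius (\<sigma> a) (\<sigma> b) (\<sigma> c) (\<sigma> d) (map_option \<sigma> z)"
proof -
  have add: "\<sigma> (x + y) = \<sigma> x + \<sigma> y" and mult: "\<sigma> (x * y) = \<sigma> x * \<sigma> y" for x y
    using assms by (auto simp: field_automorphism_def)
  have zero: "\<sigma> 0 = 0"
    using add[of 0 0] by (metis add.right_neutral add_left_cancel)
  have zero_iff: "\<sigma> x = 0 \<longleftrightarrow> x = 0" for x
    using assms zero by (metis bij_pointE field_automorphism_def)
  have div: "\<sigma> (x / y) = \<sigma> x / \<sigma> y" for x y
  proof (cases "y = 0")
    case False
    then have "\<sigma> (x / y) * \<sigma> y = \<sigma> x"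
      by (simp flip: mult)
    then show ?thesis
      using False zero_iff by (simp add: field_simps)
  qed (simp add: zero)
  have den: "\<sigma> c * \<sigma> x + \<sigma> d = 0 \<longleftrightarrow> c * x + d = 0" for x
    by (simp add: zero_iff flip: mult add)
  show ?thesis
    by (cases z) (auto simp: den zero_iff div add mult)
qed

lemma field_automorphism_simps:
  assumes "field_automorphism \<sigma>"
  shows "\<sigma> 0 = 0" "\<sigma> 1 = 1" "\<sigma> (x + y) = \<sigma> x + \<sigma> y" "\<sigma> (x * y) = \<sigma> x * \<sigma> y"
    "\<sigma> (- x) = - \<sigma> x" "\<sigma> (x - y) = \<sigma> x - \<sigma> y"
proof -
  have add: "\<sigma> (x + y) = \<sigma> x + \<sigma> y" for x y
    using assms by (auto simp: field_automorphism_def)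
  show "\<sigma> 1 = 1" "\<sigma> (x + y) = \<sigma> x + \<sigma> y" "\<sigma> (x * y) = \<sigma> x * \<sigma> y"
    using assms by (auto simp: field_automorphism_def)
  show 0: "\<sigma> 0 = 0"
    using add[of 0 0] by (metis add.right_neutral add_left_cancel)
  show m: "\<sigma> (- x) = - \<sigma> x" for x
    using add[of x "- x"] 0 by (simp add: eq_neg_iff_add_eq_0 add.commute)
  show "\<sigma> (x - y) = \<sigma> x - \<sigma> y"
    using add[of x "- y"] m by simp
qed

section \<open>Steiner quadruple systems on the projective line\<close>

lemma sqs_block_unique:
  assumes "steiner_quadruple_system v X B" "T \<subseteq> X" "card T = 3"
    and "b \<in> B" "T \<subseteq> b" "b' \<in> B" "T \<subseteq> b'"
  shows "b = b'"
proof -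
  have "\<exists>!b. b \<in> B \<and> T \<subseteq> b"
    using assms(1-3) by (simp add: steiner_quadruple_system_def)
  then show ?thesis
    using assms(4-7) by blast
qed

lemma sqs_block_exists:
  assumes "steiner_quadruple_system v X B" "T \<subseteq> X" "card T = 3"
  obtains w where "w \<in> X" "w \<notin> T" "insert w T \<in> B"
proof -
  obtain b where b: "b \<in> B" "T \<subseteq> b"
    using assms unfolding steiner_quadruple_system_def by blast
  then have b': "b \<subseteq> X" "card b = 4"
    using assms(1) unfolding steiner_quadruple_system_def by blast+
  then have "finite b"
    by (metis card.infinite zero_neq_numeral)
  then have "card (b - T) = 1"
    using b b' assms(3) by (simp add: card_Diff_subset finite_subset)
  then obtain w where w: "b - T = {w}"
    using card_1_singletonE by blast
  then have "b = insert w T"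
    using b(2) by blast
  then show ?thesis
    using that[of w] w b b' by blast
qed

lemma sqs_transport:
  assumes f: "bij_betw f X Y" and S: "steiner_quadruple_system v X B"
  shows "steiner_quadruple_system v Y ((`) f ` B)"
proof -
  have inj: "inj_on f X" and im: "f ` X = Y"
    using f by (auto simp: bij_betw_def)
  have fin: "finite X" "card X = v" and blocks: "\<And>b. b \<in> B \<Longrightarrow> b \<subseteq> X \<and> card b = 4"
    using S by (auto simp: steiner_quadruple_system_def)
  have ex1: "\<exists>!b. b \<in> (`) f ` B \<and> T \<subseteq> b" if T: "T \<subseteq> Y" "card T = 3" for T
  proof -
    obtain T' where T': "T' \<subseteq> X" "T = f ` T'"
      using T(1) im by (metis subset_imageE)
    have "card T' = 3"
      using T(2) T' inj by (metis card_image inj_on_subset)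
    obtain b where b: "b \<in> B" "T' \<subseteq> b"
      using sqs_block_exists[OF S T'(1) \<open>card T' = 3\<close>] by blast
    show ?thesis
    proof (rule ex1I)
      show "f ` b \<in> (`) f ` B \<and> T \<subseteq> f ` b"
        using b T' by blast
      fix c assume c: "c \<in> (`) f ` B \<and> T \<subseteq> c"
      then obtain b' where b': "b' \<in> B" "c = f ` b'"
        by blast
      have "T' \<subseteq> b'"
        using c b' T' blocks[OF b'(1)] inj by (auto dest: inj_onD)
      then show "c = f ` b"
        using sqs_block_unique[OF S T'(1) \<open>card T' = 3\<close>] b b' by blast
    qed
  qed
  have card4: "f ` b \<subseteq> Y \<and> card (f ` b) = 4" if "b \<in> B" for b
    using blocks[OF that] inj im by (metis card_image image_mono inj_on_subset)
  have "finite Y" "card Y = v"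
    using fin im inj card_image by blast+
  then show ?thesis
    unfolding steiner_quadruple_system_def using card4
    by (intro conjI allI impI ex1) auto
qed

text \<open>The image of the block is again a block through \<open>T\<close>, hence the same block.
  Injectivity keeps the image of \<open>w\<close> outside \<open>T\<close>, which leaves only
  \<open>w\<close> itself.\<close>

lemma sqs_fourth_point_fixed:
  assumes S: "steiner_quadruple_system v X B" and T: "T \<subseteq> X" "card T = 3"
    and w: "w \<notin> T" "insert w T \<in> B"
    and g: "inj_on g X" "g ` T = T" "g ` insert w T \<in> B"
  shows "g w = w"
proof -
  have "w \<in> X"
    using S w by (auto simp: steiner_quadruple_system_def)
  have "g ` insert w T = insert w T"
    using sqs_block_unique[OF S T g(3) _ w(2)] g(2) by blast
  then have "g w \<in> insert w T" by blast
  moreover have "g w \<notin> T"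
    using g w T \<open>w \<in> X\<close> by (metis inj_on_image_mem_iff)
  ultimately show ?thesis by blast
qed

section \<open>Systems invariant under \<open>L2_line\<close>\<close>

definition preserves_blocks :: "('p \<Rightarrow> 'p) set \<Rightarrow> 'p set set \<Rightarrow> bool" where
  "preserves_blocks H B \<longleftrightarrow> (\<forall>h\<in>H. \<forall>b\<in>B. h ` b \<in> B)"

lemma preserves_blocksD: "preserves_blocks H B \<Longrightarrow> h \<in> H \<Longrightarrow> b \<in> B \<Longrightarrow> h ` b \<in> B"
  by (simp add: preserves_blocks_def)

text \<open>The maps \<open>x \<mapsto> 1 / (1 - x)\<close> and, if \<open>-1\<close> is a square, \<open>x \<mapsto> 1 - x\<close> stabilise the
  triple \<open>{0, 1, \<infinity>}\<close>, so they fix the fourth point of its block.\<close>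

lemma L2_invariant_sqs_base_block:
  fixes C :: "'a::{field,finite} option set set"
  assumes S: "steiner_quadruple_system v UNIV C" and inv: "preserves_blocks L2_line C"
  obtains e where "{Some 0, Some 1, None, Some e} \<in> C" "e \<noteq> 0" "e \<noteq> 1" "e * (1 - e) = 1"
    "(\<exists>i::'a. i\<^sup>2 = -1) \<Longrightarrow> 1 - e = e"
proof -
  let ?T = "{Some 0, Some 1, None :: 'a option}"
  have T: "card ?T = 3" by simp
  obtain w where w: "w \<notin> ?T" "insert w ?T \<in> C"
    using sqs_block_exists[OF S _ T] by blast
  then obtain e where e: "w = Some e" "e \<noteq> 0" "e \<noteq> 1"
    by (cases w) auto
  have fixed: "g w = w" if "g \<in> L2_line" "g ` ?T = ?T" for g
  proof (rule sqs_fourth_point_fixed[OF S _ T w])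
    show "inj g"
      using that L2_subset_PGL2 PGL2_bij bij_is_inj by blast
    show "g ` insert w ?T \<in> C"
      using preserves_blocksD[OF inv that(1) w(2)] .
  qed (use that in auto)
  have "moebius 0 1 (-1) 1 \<in> (L2_line :: ('a option \<Rightarrow> 'a option) set)"
    by (rule moebius_in_L2[of _ _ _ _ 1]) auto
  then have "moebius 0 1 (-1) 1 w = w"
    by (rule fixed) auto
  then have "e * (1 - e) = 1"
    using e by (auto split: if_splits simp: field_simps)
  moreover have "1 - e = e" if "(i::'a)\<^sup>2 = -1" for i
  proof -
    have "i \<noteq> 0" using that by auto
    \<comment> \<open>The map x -> 1 - x has determinant -1, which is the square of
      \<open>i\<close>.\<close>
    then have "moebius (-1) 1 0 1 \<in> (L2_line :: ('a option \<Rightarrow> 'a option) set)"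
      by (intro moebius_in_L2[of _ _ _ _ i]) (auto simp: that)
    then have "moebius (-1) 1 0 1 w = w"
      by (rule fixed) auto
    then show ?thesis
      using e by auto
  qed
  moreover have "{Some 0, Some 1, None, Some e} \<in> C"
    using w e by (simp add: insert_commute)
  ultimately show ?thesis
    using that[of e] e by blast
qed

lemma block_contains_triple_image:
  fixes C :: "'a::field option set set"
  assumes "steiner_quadruple_system v UNIV C" "b \<in> C"
  obtains g where "g \<in> PGL2_line" "g ` {Some 0, Some 1, None} \<subseteq> b"
proof -
  have "card b = 4"
    using assms by (auto simp: steiner_quadruple_system_def)
  then obtain T where "T \<subseteq> b" "card T = 3"
    using obtain_subset_with_card_n[of 3 b] by auto
  then obtain p r s where "p \<noteq> r" "p \<noteq> s" "r \<noteq> s" "{p, r, s} \<subseteq> b"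
    by (auto simp: card_3_iff)
  moreover obtain g where "g \<in> PGL2_line" "g (Some 0) = p" "g (Some 1) = r" "g None = s"
    using PGL2_from_standard_triple[OF calculation(1-3)] .
  ultimately show ?thesis
    by (intro that[of g]) auto
qed

lemma card_3_triple_image:
  "inj g \<Longrightarrow> card (g ` {Some 0, Some 1, None :: 'a::field option}) = 3"
  by (subst card_image) (simp_all add: inj_on_def)

text \<open>Every block contains an image of the standard triple, and by \<open>trans\<close> one
  under some \<open>h\<close> in \<open>H\<close>. The block and the image of the base block under
  \<open>h\<close> share this triple, so they agree.\<close>

lemma images_under_eq_sqs:
  fixes C :: "'a::field option set set"
  assumes S: "steiner_quadruple_system v UNIV C" and H: "H \<subseteq> PGL2_line"
    and blocks: "\<And>g. g \<in> H \<Longrightarrow> g ` {Some 0, Some 1, None, Some e} \<in> C"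
    and trans: "\<And>g. g \<in> PGL2_line \<Longrightarrow> \<exists>h\<in>H. h ` {Some 0, Some 1, None} = g ` {Some 0, Some 1, None}"
  shows "C = images_under H {Some 0, Some 1, None, Some e}"
proof
  show "images_under H {Some 0, Some 1, None, Some e} \<subseteq> C"
    using blocks by (auto simp: images_under_def)
  show "C \<subseteq> images_under H {Some 0, Some 1, None, Some e}"
  proof
    fix b assume b: "b \<in> C"
    then obtain g where g: "g \<in> PGL2_line" "g ` {Some 0, Some 1, None} \<subseteq> b"
      using block_contains_triple_image[OF S] by blast
    then obtain h where h: "h \<in> H" "h ` {Some 0, Some 1, None} \<subseteq> b"
      using trans by metis
    have "inj h"
      using H h PGL2_bij bij_is_inj by blast
    have "b = h ` {Some 0, Some 1, None, Some e}"
      by (rule sqs_block_unique[OF S _ card_3_triple_image[OF \<open>inj h\<close>] b h(2) blocks[OF h(1)]]) auto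
    then show "b \<in> images_under H {Some 0, Some 1, None, Some e}"
      using h by (auto simp: images_under_def)
  qed
qed

text \<open>Pulling \<open>C\<close> back along any \<open>g\<close> in \<open>PGL2_line\<close>
  gives another invariant system, whose block through 0, 1 and infinity is forced to contain -1.
  Pushing forward shows that \<open>C\<close> contains the \<open>g\<close>-image of that
  block.\<close>

lemma char_3_L2_invariant_sqs:
  fixes C :: "'a::{field,finite} option set set"
  assumes three: "(3::'a) = 0"
    and S: "steiner_quadruple_system v UNIV C" and inv: "preserves_blocks L2_line C"
  shows "C = images_under PGL2_line {Some 0, Some 1, None, Some (-1)}"
proof (rule images_under_eq_sqs[OF S])
  fix g :: "'a option \<Rightarrow> 'a option" assume g: "g \<in> PGL2_line"
  show "\<exists>h\<in>PGL2_line. h ` {Some 0, Some 1, None} = g ` {Some 0, Some 1, None}"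
    using g by blast
  obtain g' where g': "g' \<in> PGL2_line" "g \<circ> g' = id" "g' \<circ> g = id"
    using PGL2_inverse[OF g] .
  \<comment> \<open>\<open>L\<^sub>2\<close> is normal in \<open>PGL\<^sub>2\<close>, so the translate of \<open>C\<close> by the inverse of \<open>g\<close> is again invariant.\<close>
  let ?C = "(`) g' ` C"
  have "steiner_quadruple_system v UNIV ?C"
    using sqs_transport[of g' UNIV UNIV, OF _ S] PGL2_bij[OF g'(1)] by simp
  moreover have "preserves_blocks L2_line ?C"
    unfolding preserves_blocks_def
  proof (intro ballI)
    fix h :: "'a option \<Rightarrow> 'a option" and b assume h: "h \<in> L2_line" and "b \<in> ?C"
    then obtain c where c: "c \<in> C" "b = g' ` c" by blast
    have "(g \<circ> h \<circ> g') ` c \<in> C"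
      using preserves_blocksD[OF inv PGL2_conj_L2[OF g g'(2) h] c(1)] .
    then have "g' ` (g \<circ> h \<circ> g') ` c \<in> ?C"
      by blast
    moreover have "g' ` (g \<circ> h \<circ> g') ` c = h ` b"
      using g'(3) unfolding c(2) image_image by (metis comp_apply id_apply)
    ultimately show "h ` b \<in> ?C" by simp
  qed
  ultimately obtain e where e: "{Some 0, Some 1, None, Some e} \<in> ?C" "e * (1 - e) = 1"
    using L2_invariant_sqs_base_block by metis
  \<comment> \<open>In characteristic 3 the polynomial x^2 - x + 1 is (x + 1)^2, so -1 is its only
    root.\<close>
  have "(e + 1)\<^sup>2 = 3 * e - (e * (1 - e) - 1)"
    by (simp add: power2_eq_square algebra_simps)
  then have "(e + 1)\<^sup>2 = 0"
    using e(2) three by simp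
  then have "e = -1"
    by (simp add: eq_neg_iff_add_eq_0)
  with e(1) obtain c where "c \<in> C" "{Some 0, Some 1, None, Some (-1)} = g' ` c"
    by blast
  moreover have "g ` g' ` c = c"
    using g'(2) by (simp add: image_image flip: comp_apply[of g g'])
  ultimately show "g ` {Some 0, Some 1, None, Some (-1)} \<in> C"
    by simp
qed simp

text \<open>The hypotheses give e^2 = 1 and 2e = 1, whence 4 = (2e)^2 = 1.\<close>

lemma sixth_root_fixed_imp_char_3:
  fixes e :: "'a::field"
  assumes "e * (1 - e) = 1" "1 - e = e"
  shows "(3::'a) = 0"
proof -
  have "e * e = 1" using assms by metis
  have "e + e = 1" using assms(2) by (metis diff_add_cancel)
  then have "(e + e) * (e + e) = 1" by simp
  then have "4 * (e * e) = 1"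
    by (simp add: algebra_simps flip: mult_2)
  then have "(4::'a) = 1" using \<open>e * e = 1\<close> by (metis mult.right_neutral)
  moreover have "(3::'a) = 4 - 1" by simp
  ultimately show ?thesis by simp
qed

text \<open>A square root of -1 would put x -> 1 - x into \<open>L2_line\<close>, fix the fourth
  point and force characteristic 3. Without such a root \<open>L2_line\<close> reaches every triple,
  so one base block determines \<open>C\<close>.\<close>

lemma char_not_3_L2_invariant_sqs:
  fixes C :: "'a::{field,finite} option set set"
  assumes three: "(3::'a) \<noteq> 0"
    and S: "steiner_quadruple_system v UNIV C" and inv: "preserves_blocks L2_line C"
  obtains e where "\<forall>x. x\<^sup>2 \<noteq> (-1::'a)" "e * (1 - e) = 1"
    "C = images_under L2_line {Some 0, Some 1, None, Some e}"
proof -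
  obtain e where e: "{Some 0, Some 1, None, Some e} \<in> C" "e \<noteq> 0" "e \<noteq> 1" "e * (1 - e) = 1"
    and sq: "(\<exists>i::'a. i\<^sup>2 = -1) \<Longrightarrow> 1 - e = e"
    using L2_invariant_sqs_base_block[OF S inv] by metis
  have ns: "\<forall>x. x\<^sup>2 \<noteq> (-1::'a)"
  proof (rule ccontr)
    assume "\<not> (\<forall>x. x\<^sup>2 \<noteq> (-1::'a))"
    then have "1 - e = e" using sq by blast
    then show False using sixth_root_fixed_imp_char_3 e(4) three by blast
  qed
  moreover have "C = images_under L2_line {Some 0, Some 1, None, Some e}"
  proof (rule images_under_eq_sqs[OF S L2_subset_PGL2])
    show "g ` {Some 0, Some 1, None, Some e} \<in> C" if "g \<in> L2_line" for g
      using preserves_blocksD[OF inv that e(1)] .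
    fix g :: "'a option \<Rightarrow> 'a option" assume g: "g \<in> PGL2_line"
    show "\<exists>h\<in>L2_line. h ` {Some 0, Some 1, None} = g ` {Some 0, Some 1, None}"
    proof (cases "g \<in> L2_line")
      case False
      \<comment> \<open>Precomposing with x -> 1 - x corrects the square class and leaves the image
        of the set {0, 1, infinity} unchanged.\<close>
      have "g \<circ> moebius (-1) 1 0 1 \<in> L2_line"
        by (rule PGL2_square_class[OF ns g False refl]) simp
      moreover have "(g \<circ> moebius (-1) 1 0 1) ` {Some 0, Some 1, None} = g ` {Some 0, Some 1, None}"
        by auto
      ultimately show ?thesis by blast
    qed blast
  qed
  ultimately show ?thesis
    using that e by blast
qed

section \<open>Primitive sixth roots of unity\<close>

lemma sixth_root_of_unity:
  fixes e :: "'a::field"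
  assumes "(3::'a) \<noteq> 0" "(2::'a) \<noteq> 0" "e * (1 - e) = 1"
  shows "primitive_root_of_unity 6 e"
proof -
  have e2: "e\<^sup>2 = e - 1"
    using assms(3) by (simp add: power2_eq_square algebra_simps)
  have e3: "e ^ 3 = -1"
  proof -
    have "e ^ 3 = e * e\<^sup>2" by (simp add: power3_eq_cube power2_eq_square)
    also have "\<dots> = - (e * (1 - e))" by (simp add: e2 algebra_simps)
    finally show ?thesis using assms(3) by simp
  qed
  have e4: "e ^ 4 = - e" and e5: "e ^ 5 = 1 - e" and e6: "e ^ 6 = 1"
  proof -
    have "e ^ 4 = e ^ 3 * e" "e ^ 5 = e ^ 3 * e\<^sup>2" "e ^ 6 = e ^ 3 * e ^ 3"
      by (simp_all flip: power_add power_Suc2)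
    then show "e ^ 4 = - e" "e ^ 5 = 1 - e" "e ^ 6 = 1"
      by (simp_all add: e3 e2)
  qed
  have ne: "e \<noteq> 0" "e \<noteq> 1" using assms(3) by auto
  have "e \<noteq> 2"
  proof
    assume "e = 2"
    then have "(2::'a) * (1 - 2) = 1" using assms(3) by simp
    then have "(3::'a) = 0" by (simp add: algebra_simps)
    then show False using assms(1) by simp
  qed
  have "e \<noteq> -1"
  proof
    assume "e = -1"
    then have "(-1) * (1 - (-1)) = (1::'a)" using assms(3) by simp
    then have "(3::'a) = 0" by (simp add: algebra_simps)
    then show False using assms(1) by simp
  qed
  have "(-1::'a) \<noteq> 1"
    using assms(2) by (metis add.right_inverse one_add_one)
  \<comment> \<open>The powers are e, e - 1, -1, -e and 1 - e. They equal 1 only if e is 1, 2, -1 or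
    0, or if -1 = 1, and each of these has been excluded.\<close>
  have "e ^ j \<noteq> 1" if "0 < j" "j < 6" for j
  proof -
    have "j \<in> {1, 2, 3, 4, 5}" using that by auto
    then show ?thesis
      using ne e2 e3 e4 e5 \<open>e \<noteq> 2\<close> \<open>e \<noteq> -1\<close> \<open>(-1::'a) \<noteq> 1\<close>
      by (auto simp: algebra_simps minus_equation_iff)
  qed
  then show ?thesis
    using e6 by (auto simp: primitive_root_of_unity_def)
qed

text \<open>Factor e^6 - 1 as (e^3 - 1)(e + 1)(e^2 - e + 1): since the order is exactly 6, the first
  two factors are nonzero.\<close>

lemma sixth_root_of_unity_relation:
  fixes e :: "'a::field"
  assumes "primitive_root_of_unity 6 e"
  shows "e * (1 - e) = 1"
proof -
  have p: "e ^ 6 = 1" "e ^ 3 \<noteq> 1" "e\<^sup>2 \<noteq> 1"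
    using assms by (auto simp: primitive_root_of_unity_def)
  have "(e ^ 3 - 1) * (e ^ 3 + 1) = e ^ 6 - 1"
    by (simp add: algebra_simps flip: power_add)
  then have "e ^ 3 + 1 = 0"
    using p by simp
  moreover have "e ^ 3 + 1 = (e + 1) * (e\<^sup>2 - e + 1)"
    by (simp add: algebra_simps power3_eq_cube power2_eq_square)
  moreover have "e + 1 \<noteq> 0"
    using p(3) by (metis add_eq_0_iff2 power2_minus one_power2)
  ultimately have "e\<^sup>2 - e + 1 = 0"
    by simp
  then show ?thesis
    by (simp add: algebra_simps power2_eq_square)
qed

text \<open>By Fermat, \<open>e\<close> raised to the remainder of q - 1 modulo 6 is 1, and
  minimality of the order 6 makes the remainder zero.\<close>

lemma primitive_root_of_unity_6_card:
  fixes e :: "'a::{field,finite}"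
  assumes "primitive_root_of_unity 6 e"
  shows "6 dvd CARD('a) - 1"
proof -
  have p: "e ^ 6 = 1" "\<And>j. 0 < j \<Longrightarrow> j < 6 \<Longrightarrow> e ^ j \<noteq> 1"
    using assms by (auto simp: primitive_root_of_unity_def)
  then have "e \<noteq> 0"
    by auto
  let ?m = "CARD('a) - 1"
  have "e ^ ?m = e ^ (6 * (?m div 6) + ?m mod 6)"
    by simp
  also have "\<dots> = e ^ (?m mod 6)"
    by (simp only: power_add power_mult p(1) power_one mult_1)
  finally have "e ^ (?m mod 6) = 1"
    using finite_field_fermat[OF \<open>e \<noteq> 0\<close>] by simp
  then have "?m mod 6 = 0"
    using p(2)[of "?m mod 6"] by (cases "?m mod 6 = 0") auto
  then show ?thesis by presburger
qed

section \<open>Semilinear fractional transformations\<close>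

text \<open>The conjugate of a translation fixes infinity, so it is affine. A linear coefficient
  other than 1 would give it a finite fixed point, which a nontrivial translation lacks.\<close>

lemma additive_if_normalises_translations:
  fixes \<sigma> :: "'a::field \<Rightarrow> 'a"
  assumes f: "f = map_option \<sigma>" and "bij \<sigma>" "\<sigma> 0 = 0"
    and norm: "\<And>g. g \<in> L2_line \<Longrightarrow> \<exists>g'\<in>L2_line. f \<circ> g = g' \<circ> f"
  shows "\<sigma> (x + b) = \<sigma> x + \<sigma> b"
proof (cases "b = 0")
  case False
  have "moebius 1 b 0 1 \<in> L2_line"
    by (rule moebius_in_L2[of _ _ _ _ 1]) auto
  then obtain g' where "g' \<in> L2_line" "f \<circ> moebius 1 b 0 1 = g' \<circ> f"
    using norm by blast
  then obtain a' b' c' d' where g': "f \<circ> moebius 1 b 0 1 = moebius a' b' c' d' \<circ> f" "a' * d' - b' * c' = 1"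
    unfolding L2_line_def by blast
  have "moebius a' b' c' d' None = None"
    using fun_cong[OF g'(1), of None] f by simp
  then have [simp]: "c' = 0"
    by (simp split: if_splits)
  have d': "d' \<noteq> 0"
    using g'(2) by auto
  have *: "\<sigma> (x + b) = a' / d' * \<sigma> x + b' / d'" for x
    using fun_cong[OF g'(1), of "Some x"] f d' by (simp add: add_divide_distrib)
  have b': "b' / d' = \<sigma> b"
    using *[of 0] \<open>\<sigma> 0 = 0\<close> by simp
  have "a' / d' = 1"
  proof (rule ccontr)
    assume ne: "a' / d' \<noteq> 1"
    \<comment> \<open>This value is the fixed point of the affine map with slope
      \<open>a' / d'\<close> and constant term \<open>\<sigma> b\<close>.\<close>
    obtain y where "\<sigma> y = \<sigma> b / (1 - a' / d')"
      using \<open>bij \<sigma>\<close> by (metis bij_pointE)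
    then have "(1 - a' / d') * \<sigma> y = \<sigma> b"
      using ne by simp
    then have "\<sigma> (y + b) = \<sigma> y"
      using *[of y] b' by (simp add: algebra_simps)
    then show False
      using \<open>bij \<sigma>\<close> False by (metis add_cancel_right_right bij_pointE)
  qed
  then show ?thesis
    using *[of x] b' by simp
qed (use \<open>\<sigma> 0 = 0\<close> in simp)

text \<open>The dilation by s^2 comes from the diagonal matrix with entries s and 1/s. Its conjugate
  fixes 0 and infinity, so it is a dilation too, with factor read off at 1.\<close>

lemma multiplicative_on_squares_if_normalises_dilations:
  fixes \<sigma> :: "'a::field \<Rightarrow> 'a"
  assumes f: "f = map_option \<sigma>" and "\<sigma> 0 = 0" "\<sigma> 1 = 1"
    and norm: "\<And>g. g \<in> L2_line \<Longrightarrow> \<exists>g'\<in>L2_line. f \<circ> g = g' \<circ> f"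
  shows "\<sigma> (s\<^sup>2 * x) = \<sigma> (s\<^sup>2) * \<sigma> x"
proof (cases "s = 0")
  case False
  have "moebius s 0 0 (1 / s) \<in> L2_line"
    using False by (intro moebius_in_L2[of _ _ _ _ 1]) auto
  then obtain g' where "g' \<in> L2_line" "f \<circ> moebius s 0 0 (1 / s) = g' \<circ> f"
    using norm by blast
  then obtain a' b' c' d' where g': "f \<circ> moebius s 0 0 (1 / s) = moebius a' b' c' d' \<circ> f" "a' * d' - b' * c' = 1"
    unfolding L2_line_def by blast
  have "moebius a' b' c' d' None = None"
    using fun_cong[OF g'(1), of None] f by simp
  then have [simp]: "c' = 0"
    by (simp split: if_splits)
  have d': "d' \<noteq> 0"
    using g'(2) by auto
  have *: "\<sigma> (s\<^sup>2 * x) = a' / d' * \<sigma> x + b' / d'" for x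
    using fun_cong[OF g'(1), of "Some x"] f d' False
    by (simp add: add_divide_distrib power2_eq_square mult_ac)
  have "b' / d' = 0"
    using *[of 0] \<open>\<sigma> 0 = 0\<close> by simp
  then show ?thesis
    using *[of x] *[of 1] \<open>\<sigma> 1 = 1\<close> d' by simp
qed (use \<open>\<sigma> 0 = 0\<close> in simp)

text \<open>Composing with an element \<open>k\<close> of \<open>PGL2_line\<close> makes the map fix
  0, 1 and infinity without losing the normalising property. Halving then extends multiplicativity
  from squares to all elements.\<close>

lemma normaliser_of_L2_subset_PGammaL2:
  fixes h :: "'a::field option \<Rightarrow> 'a option"
  assumes two: "(2::'a) \<noteq> 0" and "bij h"
    and norm: "\<And>g. g \<in> L2_line \<Longrightarrow> \<exists>g'\<in>L2_line. h \<circ> g = g' \<circ> h"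
  shows "h \<in> PGammaL2_line"
proof -
  have "h (Some 0) \<noteq> h (Some 1)" "h (Some 0) \<noteq> h None" "h (Some 1) \<noteq> h None"
    using \<open>bij h\<close> by (auto dest!: bij_is_inj injD)
  then obtain k where k: "k \<in> PGL2_line" "k (h (Some 0)) = Some 0" "k (h (Some 1)) = Some 1" "k (h None) = None"
    by (rule PGL2_to_standard_triple)
  obtain k' where k': "k' \<in> PGL2_line" "k \<circ> k' = id" "k' \<circ> k = id"
    using PGL2_inverse[OF k(1)] .
  define f where "f = k \<circ> h"
  have norm': "\<exists>g'\<in>L2_line. f \<circ> g = g' \<circ> f" if g: "g \<in> L2_line" for g
  proof -
    obtain g' where g': "g' \<in> L2_line" "h \<circ> g = g' \<circ> h"
      using norm[OF g] by blast
    have "k \<circ> g' \<circ> k' \<circ> f = k \<circ> (g' \<circ> ((k' \<circ> k) \<circ> h))"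
      by (simp add: f_def comp_assoc)
    then have "f \<circ> g = (k \<circ> g' \<circ> k') \<circ> f"
      using g'(2) by (simp add: f_def k'(3) comp_assoc)
    then show ?thesis
      using PGL2_conj_L2[OF k(1) k'(2) g'(1)] by blast
  qed
  have bijf: "bij f"
    unfolding f_def using \<open>bij h\<close> PGL2_bij[OF k(1)] by (rule bij_comp)
  have f0: "f (Some 0) = Some 0" "f (Some 1) = Some 1" "f None = None"
    using k by (auto simp: f_def)
  define \<sigma> where "\<sigma> x = the (f (Some x))" for x
  have fs: "f (Some x) = Some (\<sigma> x)" for x
    using bijf f0(3) by (metis \<sigma>_def bij_pointE option.distinct(1) option.exhaust_sel)
  have f: "f = map_option \<sigma>"
  proof
    fix z show "f z = map_option \<sigma> z"
      using f0 fs by (cases z) auto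
  qed
  have \<sigma>: "\<sigma> 0 = 0" "\<sigma> 1 = 1"
    using f0 fs by auto
  have "bij \<sigma>"
  proof (rule bijI)
    show "inj \<sigma>"
      using bijf fs by (metis bij_is_inj injD injI option.inject)
    show "surj \<sigma>"
      unfolding surj_def
    proof
      fix y
      obtain z where "f z = Some y"
        using bijf by (metis bij_pointE)
      then show "\<exists>x. y = \<sigma> x"
        using fs f0(3) by (cases z) auto
    qed
  qed
  have add: "\<sigma> (x + y) = \<sigma> x + \<sigma> y" for x y
    using additive_if_normalises_translations[OF f \<open>bij \<sigma>\<close> \<sigma>(1) norm'] .
  have diff: "\<sigma> (x - y) = \<sigma> x - \<sigma> y" for x y
    using add[of "x - y" y] by simp
  have mult: "\<sigma> (x * y) = \<sigma> x * \<sigma> y" for x y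
  proof -
    \<comment> \<open>Every element is a difference of two squares.\<close>
    define u w where "u = (x + 1) / 2" and "w = (x - 1) / 2"
    have "4 * (u\<^sup>2 - w\<^sup>2) = (2 * u)\<^sup>2 - (2 * w)\<^sup>2"
      by (simp add: algebra_simps power2_eq_square)
    also have "\<dots> = (x + 1)\<^sup>2 - (x - 1)\<^sup>2"
    proof -
      have "2 * u = x + 1" "2 * w = x - 1"
        using two by (simp_all add: u_def w_def)
      then show ?thesis by (simp only:)
    qed
    also have "\<dots> = 4 * x"
      by (simp add: algebra_simps power2_eq_square)
    finally have "4 * (u\<^sup>2 - w\<^sup>2) = 4 * x" .
    moreover have "(4::'a) \<noteq> 0"
      using two by (metis mult_eq_0_iff mult_2 numeral_Bit0)
    ultimately have x: "x = u\<^sup>2 - w\<^sup>2"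
      by (metis mult_left_cancel)
    have sq: "\<sigma> (s\<^sup>2 * y) = \<sigma> (s\<^sup>2) * \<sigma> y" for s
      using multiplicative_on_squares_if_normalises_dilations[OF f \<sigma> norm'] .
    show ?thesis
      by (simp add: x left_diff_distrib diff sq)
  qed
  have "field_automorphism \<sigma>"
    unfolding field_automorphism_def using \<open>bij \<sigma>\<close> \<sigma> add mult by blast
  moreover have "h = k' \<circ> map_option \<sigma>"
    unfolding f[symmetric] f_def by (simp add: k'(3) flip: comp_assoc)
  ultimately show ?thesis
    using k'(1) unfolding PGammaL2_line_def by blast
qed

section \<open>Semilinear groups acting on orbits of a base block\<close>

lemma base_in_images_under: "id \<in> H \<Longrightarrow> S \<in> images_under H S"
  unfolding images_under_def by (metis (mono_tags, lifting) image_id id_apply mem_Collect_eq)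

lemma preserves_blocks_images_under:
  assumes "\<And>g h. g \<in> H \<Longrightarrow> h \<in> H \<Longrightarrow> g \<circ> h \<in> H"
  shows "preserves_blocks H (images_under H S)"
  unfolding preserves_blocks_def
proof (intro ballI)
  fix g b assume "g \<in> H" "b \<in> images_under H S"
  then obtain h where "h \<in> H" "b = h ` S"
    by (auto simp: images_under_def)
  then have "g \<circ> h \<in> H" "g ` b = (g \<circ> h) ` S"
    using assms[OF \<open>g \<in> H\<close>] by (simp_all add: image_comp)
  then show "g ` b \<in> images_under H S"
    unfolding images_under_def by blast
qed

text \<open>Moving \<open>s\<close> past \<open>h\<close> costs only a change to \<open>h'\<close>
  in \<open>H\<close>, after which \<open>s\<close> is absorbed by the base block.\<close>

lemma semilinear_preserves_images_under:
  assumes H: "\<And>g h. g \<in> H \<Longrightarrow> h \<in> H \<Longrightarrow> g \<circ> h \<in> H"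
    and conj: "\<And>h. h \<in> H \<Longrightarrow> \<exists>h'\<in>H. s \<circ> h = h' \<circ> s"
    and s: "s ` S = S" and g: "g \<in> H" and b: "b \<in> images_under H S"
  shows "(g \<circ> s) ` b \<in> images_under H S"
proof -
  obtain h where h: "h \<in> H" "b = h ` S"
    using b by (auto simp: images_under_def)
  obtain h' where h': "h' \<in> H" "s \<circ> h = h' \<circ> s"
    using conj[OF h(1)] by blast
  have "(g \<circ> s) ` b = g ` (s \<circ> h) ` S"
    by (simp add: h(2) image_comp comp_assoc)
  also have "\<dots> = (g \<circ> h') ` (s ` S)"
    unfolding h'(2) by (simp add: image_comp comp_assoc)
  finally have "(g \<circ> s) ` b = (g \<circ> h') ` S"
    using s by simp
  then show ?thesis
    using H[OF g h'(1)] unfolding images_under_def by blast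
qed

lemma map_option_conj_PGL2:
  assumes "field_automorphism \<sigma>" "h \<in> PGL2_line"
  shows "\<exists>h'\<in>PGL2_line. map_option \<sigma> \<circ> h = h' \<circ> map_option \<sigma>"
proof -
  obtain a b c d where h: "h = moebius a b c d" "a * d - b * c \<noteq> 0"
    using assms by (auto simp: PGL2_line_def)
  have "\<sigma> a * \<sigma> d - \<sigma> b * \<sigma> c = \<sigma> (a * d - b * c)"
    using field_automorphism_simps[OF assms(1)] by metis
  moreover have "\<sigma> (a * d - b * c) \<noteq> 0"
    using h(2) assms(1) field_automorphism_simps(1)[OF assms(1)]
    by (metis bij_pointE field_automorphism_def)
  ultimately have "moebius (\<sigma> a) (\<sigma> b) (\<sigma> c) (\<sigma> d) \<in> PGL2_line"
    by (intro moebius_in_PGL2) simp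
  moreover have "map_option \<sigma> \<circ> h = moebius (\<sigma> a) (\<sigma> b) (\<sigma> c) (\<sigma> d) \<circ> map_option \<sigma>"
    unfolding h(1) comp_def by (rule ext) (rule map_option_moebius[OF assms(1)])
  ultimately show ?thesis
    by blast
qed

lemma map_option_conj_L2:
  assumes "field_automorphism \<sigma>" "h \<in> L2_line"
  shows "\<exists>h'\<in>L2_line. map_option \<sigma> \<circ> h = h' \<circ> map_option \<sigma>"
proof -
  obtain a b c d where h: "h = moebius a b c d" "a * d - b * c = 1"
    using assms by (auto simp: L2_line_def)
  have "\<sigma> a * \<sigma> d - \<sigma> b * \<sigma> c = 1"
    using field_automorphism_simps[OF assms(1)] h(2) by metis
  then have "moebius (\<sigma> a) (\<sigma> b) (\<sigma> c) (\<sigma> d) \<in> L2_line"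
    by (auto simp: L2_line_def)
  moreover have "map_option \<sigma> \<circ> h = moebius (\<sigma> a) (\<sigma> b) (\<sigma> c) (\<sigma> d) \<circ> map_option \<sigma>"
    unfolding h(1) comp_def by (rule ext) (rule map_option_moebius[OF assms(1)])
  ultimately show ?thesis
    by blast
qed

text \<open>Field automorphisms fix 0, 1, -1 and infinity, hence the base block, and they normalise
  \<open>PGL2_line\<close>.\<close>

lemma PGammaL2_preserves_blocks:
  "preserves_blocks PGammaL2_line (images_under PGL2_line {Some 0, Some 1, None, Some (-1::'a::field)})"
  unfolding preserves_blocks_def
proof (intro ballI)
  fix h :: "'a option \<Rightarrow> 'a option" and b
  assume "h \<in> PGammaL2_line" and b: "b \<in> images_under PGL2_line {Some 0, Some 1, None, Some (-1::'a)}"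
  then obtain g \<sigma> where h: "h = g \<circ> map_option \<sigma>" "g \<in> PGL2_line" "field_automorphism \<sigma>"
    by (auto simp: PGammaL2_line_def)
  have "map_option \<sigma> ` {Some 0, Some 1, None, Some (-1)} = {Some 0, Some 1, None, Some (-1)}"
    using field_automorphism_simps[OF h(3)] by simp
  then show "h ` b \<in> images_under PGL2_line {Some 0, Some 1, None, Some (-1)}"
    unfolding h(1)
    by (intro semilinear_preserves_images_under[OF PGL2_comp map_option_conj_PGL2[OF h(3)] _ h(2) b])
qed

text \<open>An automorphism moving the root \<open>e\<close> of \<open>x\<^sup>2 - x + 1\<close> negates \<open>2 * e - 1\<close>, which is
  \<open>u\<^sup>2\<close> or \<open>- u\<^sup>2\<close>; then \<open>\<sigma> u / u\<close> is a square root of \<open>-1\<close>.\<close>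

lemma field_automorphism_fixes_sixth_root:
  fixes e :: "'a::{field,finite}"
  assumes ns: "\<forall>x. x\<^sup>2 \<noteq> (-1::'a)" and e: "e * (1 - e) = 1" and \<sigma>: "field_automorphism \<sigma>"
  shows "\<sigma> e = e"
proof (rule ccontr)
  assume ne: "\<sigma> e \<noteq> e"
  note \<sigma>s = field_automorphism_simps[OF \<sigma>]
  have "\<sigma> e * (1 - \<sigma> e) = 1"
    using e \<sigma>s by metis
  \<comment> \<open>The roots of x^2 - x + 1 are \<open>e\<close> and \<open>1 - e\<close>, so a
    moved root must go to the other one.\<close>
  moreover have "(\<sigma> e - e) * (\<sigma> e - (1 - e)) = e * (1 - e) - \<sigma> e * (1 - \<sigma> e)"
    by (simp add: algebra_simps)
  ultimately have *: "\<sigma> e = 1 - e"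
    using ne e by simp
  define w where "w = e - (1 - e)"
  have "w \<noteq> 0"
    using ne * by (simp add: w_def)
  have "\<sigma> w = - w"
    unfolding w_def \<sigma>s(6) \<sigma>s(2) * by simp
  note w = \<open>w \<noteq> 0\<close> this
  obtain u where u: "w = u\<^sup>2 \<or> w = - (u\<^sup>2)"
    using square_or_minus_square[OF ns] .
  have "\<sigma> (u\<^sup>2) = - (u\<^sup>2)"
    using u w(2) by (metis \<sigma>s(5) minus_minus)
  then have "(\<sigma> u)\<^sup>2 = - (u\<^sup>2)"
    by (simp add: power2_eq_square \<sigma>s)
  moreover have "u \<noteq> 0"
    using u w(1) by auto
  ultimately have "(\<sigma> u / u)\<^sup>2 = -1"
    by (simp add: power_divide)
  then show False
    using ns by blast
qed

lemma PSigmaL2_preserves_blocks: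
  fixes e :: "'a::{field,finite}"
  assumes "\<forall>x. x\<^sup>2 \<noteq> (-1::'a)" "e * (1 - e) = 1"
  shows "preserves_blocks PSigmaL2_line (images_under L2_line {Some 0, Some 1, None, Some e})"
  unfolding preserves_blocks_def
proof (intro ballI)
  fix h :: "'a option \<Rightarrow> 'a option" and b
  assume "h \<in> PSigmaL2_line" and b: "b \<in> images_under L2_line {Some 0, Some 1, None, Some e}"
  then obtain g \<sigma> where h: "h = g \<circ> map_option \<sigma>" "g \<in> L2_line" "field_automorphism \<sigma>"
    by (auto simp: PSigmaL2_line_def)
  have "map_option \<sigma> ` {Some 0, Some 1, None, Some e} = {Some 0, Some 1, None, Some e}"
    using field_automorphism_simps[OF h(3)] field_automorphism_fixes_sixth_root[OF assms h(3)] by simp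
  then show "h ` b \<in> images_under L2_line {Some 0, Some 1, None, Some e}"
    unfolding h(1)
    by (intro semilinear_preserves_images_under[OF L2_comp map_option_conj_L2[OF h(3)] _ h(2) b])
qed

text \<open>If the linear part \<open>g\<close> were outside \<open>L2_line\<close>, composing it
  with x -> 1 - x, which exchanges \<open>e\<close> and \<open>1 - e\<close>, would make {0, 1,
  infinity, 1 - e} a block as well. Uniqueness then gives e = 1 - e, which forces characteristic
  3.\<close>

lemma PGammaL2_automorphism_in_PSigmaL2:
  fixes e :: "'a::{field,finite}"
  assumes ns: "\<forall>x. x\<^sup>2 \<noteq> (-1::'a)" and e: "e * (1 - e) = 1" and three: "(3::'a) \<noteq> 0"
    and C: "C = images_under L2_line {Some 0, Some 1, None, Some e}"
    and S: "steiner_quadruple_system v UNIV C"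
    and h: "h \<in> PGammaL2_line" and hC: "\<And>b. b \<in> C \<Longrightarrow> h ` b \<in> C"
  shows "h \<in> PSigmaL2_line"
proof -
  obtain g \<sigma> where g: "h = g \<circ> map_option \<sigma>" "g \<in> PGL2_line" "field_automorphism \<sigma>"
    using h by (auto simp: PGammaL2_line_def)
  let ?S = "{Some 0, Some 1, None, Some e}" and ?S' = "{Some 0, Some 1, None, Some (1 - e)}"
  have "g \<in> L2_line"
  proof (rule ccontr)
    assume nL: "g \<notin> L2_line"
    define t :: "'a option \<Rightarrow> 'a option" where "t = moebius (-1) 1 0 1"
    have gt: "g \<circ> t \<in> L2_line"
      by (rule PGL2_square_class[OF ns g(2) nL t_def]) simp
    have tt: "t ` ?S' = ?S"
      by (auto simp: t_def)
    have "?S \<in> C"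
      unfolding C by (rule base_in_images_under[OF id_in_L2])
    have "h ` ?S = g ` ?S"
      using field_automorphism_simps[OF g(3)] field_automorphism_fixes_sixth_root[OF ns e g(3)]
      by (simp add: g(1))
    then have "(g \<circ> t) ` ?S' \<in> C"
      using hC[OF \<open>?S \<in> C\<close>] tt by (metis image_comp)
    moreover obtain k where "k \<in> L2_line" "k \<circ> (g \<circ> t) = id"
      using L2_inverse[OF gt] by blast
    moreover have "preserves_blocks L2_line C"
      unfolding C by (rule preserves_blocks_images_under[OF L2_comp])
    ultimately have "?S' \<in> C"
      using preserves_blocksD[of L2_line C k "(g \<circ> t) ` ?S'"] by (simp only: image_comp image_id id_apply)
    have "?S = ?S'"
      by (rule sqs_block_unique[OF S _ _ \<open>?S \<in> C\<close> _ \<open>?S' \<in> C\<close>, of "{Some 0, Some 1, None}"]) auto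
    moreover have "e \<noteq> 0" "e \<noteq> 1"
      using e by auto
    ultimately have "1 - e = e"
      by (auto simp: doubleton_eq_iff insert_eq_iff)
    then show False
      using sixth_root_fixed_imp_char_3[OF e] three by blast
  qed
  then show ?thesis
    using g unfolding PSigmaL2_line_def by blast
qed

lemma prime_subfield_char_3:
  assumes "(3::'a::{field,finite}) = 0"
  shows "insert None (Some ` prime_subfield) = {Some 0, Some 1, None, Some (-1::'a)}"
proof -
  have "of_int i \<in> {0, 1, -1::'a}" for i :: int
  proof -
    have "i = 3 * (i div 3) + i mod 3"
      by simp
    then have "(of_int i :: 'a) = 3 * of_int (i div 3) + of_int (i mod 3)"
      by (metis of_int_add of_int_mult of_int_numeral)
    then have "(of_int i :: 'a) = of_int (i mod 3)"
      using assms by simp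
    moreover have "i mod 3 \<in> {0, 1, 2}"
      by auto
    moreover have "(2::'a) = -1"
    proof -
      have "(2::'a) = 3 - 1" by simp
      then show ?thesis using assms by simp
    qed
    ultimately show ?thesis
      by auto
  qed
  then have "prime_subfield \<subseteq> {0, 1, -1::'a}"
    unfolding prime_subfield_def by (rule image_subsetI)
  moreover have "(0::'a) \<in> prime_subfield" "(1::'a) \<in> prime_subfield" "(-1::'a) \<in> prime_subfield"
    unfolding prime_subfield_def using rangeI[of of_int 0] rangeI[of of_int 1] rangeI[of of_int "-1"] by simp_all
  ultimately have "prime_subfield = {0, 1, -1::'a}"
    by blast
  then show ?thesis
    by auto
qed

section \<open>The classification on the projective line\<close>

text \<open>These are the three alternatives of the theorem with \<open>CARD('a)\<close> for q,
  worded alike so that unfolding turns results on the line into the final statement.\<close>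

definition classified :: "'a::{field,finite} option set set \<Rightarrow> ('a option \<Rightarrow> 'a option) set \<Rightarrow> bool" where
  "classified C K \<longleftrightarrow>
     (\<exists>d. CARD('a) = 3 ^ d \<and>
        (d \<ge> 2 \<and> C = images_under PGL2_line (insert None (Some ` prime_subfield)) \<or>
         d > 1 \<and> odd d \<and> C = images_under L2_line (insert None (Some ` prime_subfield))) \<and>
        L2_line \<subseteq> K \<and> K \<subseteq> PGammaL2_line)
     \<or>
     (CARD('a) mod 12 = 7 \<and>
      (\<exists>\<epsilon>. primitive_root_of_unity 6 \<epsilon> \<and>
         C = images_under L2_line {Some 0, Some 1, None, Some \<epsilon>}) \<and>
      L2_line \<subseteq> K \<and> K \<subseteq> PSigmaL2_line)
     \<or>
     (\<exists>d. d \<ge> 1 \<and> CARD('a) = 3 ^ (2 * d) \<and>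
        (\<exists>a. a \<noteq> 0 \<and> (\<nexists>b. a = b ^ 2) \<and>
           images_under L2_line {Some 0, Some 1, Some (- 1), None} \<inter>
             images_under L2_line {Some 0, Some 1, Some a, None} = {} \<and>
           C = images_under L2_line {Some 0, Some 1, Some (- 1), None} \<union>
             images_under L2_line {Some 0, Some 1, Some a, None}) \<and>
        L2_line \<subseteq> K \<and> K \<subseteq> PSigmaL2_line)"

text \<open>Characteristic 3 leads to the first alternative with the \<open>PGL2_line\<close> orbit;
  every other characteristic leads to the second.\<close>

lemma classified_if_automorphisms:
  fixes C :: "'a::{field,finite} option set set"
  assumes card: "CARD('a) \<noteq> 3"
    and S: "steiner_quadruple_system v UNIV C"
    and L2: "L2_line \<subseteq> K" and K: "preserves_blocks K C"
    and norm: "\<And>h g. h \<in> K \<Longrightarrow> g \<in> L2_line \<Longrightarrow> \<exists>g'\<in>L2_line. h \<circ> g = g' \<circ> h"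
    and bij: "\<And>h. h \<in> K \<Longrightarrow> bij h"
  shows "classified C K"
proof -
  have inv: "preserves_blocks L2_line C"
    using L2 K by (auto simp: preserves_blocks_def)
  have Gamma: "K \<subseteq> PGammaL2_line" if "(2::'a) \<noteq> 0"
    using normaliser_of_L2_subset_PGammaL2[OF that] bij norm by blast
  show ?thesis
  proof (cases "(3::'a) = 0")
    case True
    obtain d where d: "CARD('a) = 3 ^ d"
      using char_3_imp_card_power[OF True] .
    have "d \<noteq> 0"
    proof
      assume "d = 0"
      then have "card (UNIV :: 'a set) = 1" using d by simp
      then show False
        by (metis UNIV_I card_1_singletonE singletonD zero_neq_one)
    qed
    \<comment> \<open>The exclusion of q = 3 enters here.\<close>
    moreover have "d \<noteq> 1"
      using d card by auto
    ultimately have "d \<ge> 2" by linarith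
    moreover have "(2::'a) \<noteq> 0"
    proof
      assume "(2::'a) = 0"
      then have "(3::'a) = 1" by (metis add_0 numeral_plus_one semiring_norm(5))
      then show False using True by simp
    qed
    moreover have "C = images_under PGL2_line (insert None (Some ` prime_subfield))"
      using char_3_L2_invariant_sqs[OF True S inv] prime_subfield_char_3[OF True] by simp
    ultimately show ?thesis
      using d L2 Gamma unfolding classified_def by blast
  next
    case False
    obtain e where e: "\<forall>x. x\<^sup>2 \<noteq> (-1::'a)" "e * (1 - e) = 1"
      "C = images_under L2_line {Some 0, Some 1, None, Some e}"
      using char_not_3_L2_invariant_sqs[OF False S inv] .
    \<comment> \<open>In characteristic 2 the element 1 would be a square root of -1.\<close>
    have two: "(2::'a) \<noteq> 0"
    proof
      assume "(2::'a) = 0"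
      then have "(1::'a)\<^sup>2 = -1"
        by (metis eq_neg_iff_add_eq_0 one_add_one one_power2)
      then show False using e(1) by blast
    qed
    have prim: "primitive_root_of_unity 6 e"
      using sixth_root_of_unity[OF False two e(2)] .
    have "CARD('a) mod 4 = 3"
      using minus_one_nonsquare_imp_mod_4[OF e(1)] .
    moreover have "6 dvd CARD('a) - 1"
      using primitive_root_of_unity_6_card[OF prim] .
    \<comment> \<open>The residues 3 modulo 4 and 1 modulo 6 combine to 7 modulo 12.\<close>
    ultimately have "CARD('a) mod 12 = 7"
      by presburger
    moreover have "K \<subseteq> PSigmaL2_line"
    proof
      fix h assume h: "h \<in> K"
      show "h \<in> PSigmaL2_line"
        using PGammaL2_automorphism_in_PSigmaL2[OF e(1,2) False e(3) S] Gamma[OF two] h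
          preserves_blocksD[OF K h] by blast
    qed
    ultimately show ?thesis
      using prim e(3) L2 unfolding classified_def by blast
  qed
qed

lemma automorphisms_if_classified:
  fixes C :: "'a::{field,finite} option set set"
  assumes S: "steiner_quadruple_system v UNIV C" and K: "classified C K"
  shows "preserves_blocks K C"
  using K unfolding classified_def
proof (elim disjE)
  assume "\<exists>d. CARD('a) = 3 ^ d \<and>
        (d \<ge> 2 \<and> C = images_under PGL2_line (insert None (Some ` prime_subfield)) \<or>
         d > 1 \<and> odd d \<and> C = images_under L2_line (insert None (Some ` prime_subfield))) \<and>
        L2_line \<subseteq> K \<and> K \<subseteq> PGammaL2_line"
  then obtain d where d: "CARD('a) = 3 ^ d" "K \<subseteq> PGammaL2_line"
    and C: "C = images_under PGL2_line (insert None (Some ` prime_subfield)) \<or>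
      C = images_under L2_line (insert None (Some ` prime_subfield))"
    by blast
  have "preserves_blocks L2_line C"
    using C
  proof
    assume "C = images_under PGL2_line (insert None (Some ` prime_subfield))"
    then have "preserves_blocks PGL2_line C"
      using preserves_blocks_images_under[OF PGL2_comp] by blast
    then show ?thesis
      using L2_subset_PGL2 unfolding preserves_blocks_def by blast
  next
    assume "C = images_under L2_line (insert None (Some ` prime_subfield))"
    then show ?thesis
      using preserves_blocks_images_under[OF L2_comp] by blast
  qed
  \<comment> \<open>Whichever orbit is given, a quadruple system invariant under
    \<open>L2_line\<close> in characteristic 3 is the \<open>PGL2_line\<close> orbit, on which all
    of \<open>PGammaL2_line\<close> acts.\<close>
  then have "C = images_under PGL2_line {Some 0, Some 1, None, Some (-1)}"
    using char_3_L2_invariant_sqs[OF card_power_3_imp_char_3[OF d(1)] S] by blast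
  then show ?thesis
    using PGammaL2_preserves_blocks[where 'a = 'a] d(2) unfolding preserves_blocks_def by blast
next
  assume "CARD('a) mod 12 = 7 \<and>
      (\<exists>\<epsilon>. primitive_root_of_unity 6 \<epsilon> \<and>
         C = images_under L2_line {Some 0, Some 1, None, Some \<epsilon>}) \<and>
      L2_line \<subseteq> K \<and> K \<subseteq> PSigmaL2_line"
  then obtain e where e: "CARD('a) mod 12 = 7" "primitive_root_of_unity 6 e"
    "C = images_under L2_line {Some 0, Some 1, None, Some e}" "K \<subseteq> PSigmaL2_line"
    by blast
  have "CARD('a) mod 4 = 3"
    using e(1) by presburger
  then have "\<forall>x. x\<^sup>2 \<noteq> (-1::'a)"
    using mod_4_imp_minus_one_nonsquare by blast
  then show ?thesis
    using PSigmaL2_preserves_blocks[OF _ sixth_root_of_unity_relation[OF e(2)]] e(3,4)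
    unfolding preserves_blocks_def by blast
next
  \<comment> \<open>No system is of this form: both base blocks would contain the triple \<open>{0, 1, \<infinity>}\<close>.\<close>
  assume "\<exists>d. d \<ge> 1 \<and> CARD('a) = 3 ^ (2 * d) \<and>
        (\<exists>a. a \<noteq> 0 \<and> (\<nexists>b. a = b ^ 2) \<and>
           images_under L2_line {Some 0, Some 1, Some (- 1), None} \<inter>
             images_under L2_line {Some 0, Some 1, Some a, None} = {} \<and>
           C = images_under L2_line {Some 0, Some 1, Some (- 1), None} \<union>
             images_under L2_line {Some 0, Some 1, Some a, None}) \<and>
        L2_line \<subseteq> K \<and> K \<subseteq> PSigmaL2_line"
  then obtain a :: 'a where a:
    "images_under L2_line {Some 0, Some 1, Some (- 1), None} \<inter>
      images_under L2_line {Some 0, Some 1, Some a, None} = {}"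
    "C = images_under L2_line {Some 0, Some 1, Some (- 1), None} \<union>
      images_under L2_line {Some 0, Some 1, Some a, None}"
    by blast
  let ?b1 = "{Some 0, Some 1, Some (- 1), None :: 'a option}" and ?b2 = "{Some 0, Some 1, Some a, None}"
  have b: "?b1 \<in> images_under L2_line ?b1" "?b2 \<in> images_under L2_line ?b2"
    by (rule base_in_images_under[OF id_in_L2])+
  then have "?b1 = ?b2"
    using a(2) by (intro sqs_block_unique[OF S _ _ _ _ _, of "{Some 0, Some 1, None}"]) auto
  then show ?thesis
    using a(1) b by auto
qed

section \<open>The groups \<open>SL\<^sub>n\<close> and \<open>PSL\<^sub>n\<close>\<close>

lemma group_SL: "group (SL :: ('a::field ^ 'n ^ 'n) monoid)"
proof (rule groupI)
  show "\<exists>B\<in>carrier SL. B \<otimes>\<^bsub>SL\<^esub> A = \<one>\<^bsub>SL\<^esub>" if "A \<in> carrier SL" for A :: "'a ^ 'n ^ 'n"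
  proof -
    have A: "det A = 1"
      using that by (simp add: SL_def)
    then have "invertible A"
      by (simp add: invertible_det_nz)
    then obtain B where B: "B ** A = mat 1"
      by (auto simp: invertible_def)
    then have "det B * det A = 1"
      by (metis det_mul det_I)
    then show ?thesis
      using A B by (intro bexI[of _ B]) (auto simp: SL_def)
  qed
qed (auto simp: SL_def det_mul matrix_mul_assoc)

lemma SL_simps:
  "carrier SL = {A. det A = 1}" "A \<otimes>\<^bsub>SL\<^esub> B = A ** B" "\<one>\<^bsub>SL\<^esub> = mat 1"
  by (simp_all add: SL_def)

lemma scalar_matrix_mult_nth:
  fixes A :: "'a::field ^ 'n ^ 'n"
  shows "(mat c ** A) $ i $ j = c * A $ i $ j" "(A ** mat c) $ i $ j = A $ i $ j * c"
proof -
  have "(\<Sum>k\<in>UNIV. (if i = k then c else 0) * A $ k $ j) = (\<Sum>k\<in>UNIV. if k = i then c * A $ i $ j else 0)"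
    by (rule sum.cong) auto
  then show "(mat c ** A) $ i $ j = c * A $ i $ j"
    by (simp add: matrix_matrix_mult_def mat_def)
  have "(\<Sum>k\<in>UNIV. A $ i $ k * (if k = j then c else 0)) = (\<Sum>k\<in>UNIV. if k = j then A $ i $ j * c else 0)"
    by (rule sum.cong) auto
  then show "(A ** mat c) $ i $ j = A $ i $ j * c"
    by (simp add: matrix_matrix_mult_def mat_def)
qed

lemma mat_mult_scalar:
  fixes A :: "'a::field ^ 'n ^ 'n"
  shows "mat c ** A = A ** mat c"
  by (simp add: vec_eq_iff scalar_matrix_mult_nth mult.commute)

lemma mat_mult_mat: "mat c ** mat d = (mat (c * d) :: 'a::field ^ 'n ^ 'n)"
  by (simp add: vec_eq_iff scalar_matrix_mult_nth) (simp add: mat_def)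

text \<open>Scalar matrices are central, so conjugation fixes each of them.\<close>

lemma SL_scalars_normal: "SL_scalars \<lhd> (SL :: ('a::field ^ 'n ^ 'n) monoid)"
proof -
  interpret SL: group "SL :: ('a ^ 'n ^ 'n) monoid"
    by (rule group_SL)
  have comm: "A ** B = B ** A" if "B \<in> SL_scalars" for A B :: "'a ^ 'n ^ 'n"
    using that mat_mult_scalar[of _ A] by (auto simp: SL_scalars_def)
  have sub: "subgroup SL_scalars (SL :: ('a ^ 'n ^ 'n) monoid)"
  proof (rule SL.subgroupI)
    show "SL_scalars \<subseteq> carrier (SL :: ('a ^ 'n ^ 'n) monoid)"
      by (auto simp: SL_scalars_def)
    show "SL_scalars \<noteq> ({} :: ('a ^ 'n ^ 'n) set)"
      by (auto simp: SL_scalars_def SL_simps intro!: exI[of _ "mat 1"])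
    show "A \<otimes>\<^bsub>SL\<^esub> B \<in> SL_scalars" if AB: "A \<in> SL_scalars" "B \<in> SL_scalars" for A B :: "'a ^ 'n ^ 'n"
    proof -
      obtain c d where "A = mat c" "B = mat d"
        using AB by (auto simp: SL_scalars_def)
      then have "A ** B = mat (c * d)"
        by (simp add: mat_mult_mat)
      moreover have "det (A ** B) = 1"
        using AB by (simp add: SL_scalars_def SL_simps det_mul)
      ultimately show ?thesis
        by (auto simp: SL_scalars_def SL_simps)
    qed
    show "inv\<^bsub>SL\<^esub> A \<in> SL_scalars" if A: "A \<in> SL_scalars" for A :: "'a ^ 'n ^ 'n"
    proof -
      obtain c where c: "A = mat c"
        using A by (auto simp: SL_scalars_def)
      have "det A = 1"
        using A by (simp add: SL_scalars_def SL_simps)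
      then have "c \<noteq> 0"
        by (metis c det_0 zero_neq_one)
      then have inv: "mat (1 / c) ** A = mat 1"
        by (simp add: c mat_mult_mat)
      then have "det (mat (1 / c) :: 'a ^ 'n ^ 'n) = 1"
        using \<open>det A = 1\<close> by (metis det_I det_mul mult.right_neutral)
      moreover have "inv\<^bsub>SL\<^esub> A = mat (1 / c)"
        using inv calculation \<open>det A = 1\<close> by (intro SL.inv_equality) (simp_all add: SL_simps)
      ultimately show ?thesis
        by (auto simp: SL_scalars_def SL_simps)
    qed
  qed
  have "A \<otimes>\<^bsub>SL\<^esub> B \<otimes>\<^bsub>SL\<^esub> inv\<^bsub>SL\<^esub> A \<in> SL_scalars"
    if "A \<in> carrier SL" "B \<in> SL_scalars" for A B :: "'a ^ 'n ^ 'n"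
  proof -
    have "B \<in> carrier SL"
      using that(2) by (simp add: SL_scalars_def)
    moreover have "A \<otimes>\<^bsub>SL\<^esub> B = B \<otimes>\<^bsub>SL\<^esub> A"
      using comm[OF that(2)] by (simp add: SL_simps)
    ultimately show ?thesis
      using that by (simp add: SL.m_assoc)
  qed
  then show ?thesis
    using sub SL.normal_inv_iff by blast
qed

lemma group_PSL: "group (PSL :: ('a::field ^ 'n ^ 'n) set monoid)"
  unfolding PSL_def by (rule normal.factorgroup_is_group[OF SL_scalars_normal])

lemma carrier_PSL: "carrier PSL = (\<lambda>A. SL_scalars #>\<^bsub>SL\<^esub> A) ` carrier SL"
  by (auto simp: PSL_def FactGroup_def RCOSETS_def)

text \<open>An automorphism turns conjugation by \<open>x\<close> into conjugation by
  \<open>h x\<close>; this is why the inner automorphisms are normal.\<close>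

lemma (in group) auto_mult_inner_automorphism:
  assumes h: "h \<in> auto G" and x: "x \<in> carrier G" and inner: "inner_automorphism G ` carrier G \<subseteq> auto G"
  shows "h \<otimes>\<^bsub>AutoGroup G\<^esub> inner_automorphism G x = inner_automorphism G (h x) \<otimes>\<^bsub>AutoGroup G\<^esub> h"
proof -
  have hom: "h \<in> hom G G" and bij: "h \<in> Bij (carrier G)"
    using h by (auto simp: auto_def)
  have hx: "h x \<in> carrier G"
    using hom x by (simp add: hom_in_carrier)
  then have bijs: "inner_automorphism G x \<in> Bij (carrier G)" "inner_automorphism G (h x) \<in> Bij (carrier G)"
    using inner x by (auto simp: auto_def)
  interpret h: group_hom G G h
    by unfold_locales (rule hom)
  have "compose (carrier G) h (inner_automorphism G x) = compose (carrier G) (inner_automorphism G (h x)) h"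
    using x by (intro ext) (simp add: compose_def inner_automorphism_def)
  then show ?thesis
    using bij bijs by (simp add: AutoGroup_def BijGroup_def)
qed

text \<open>The commutation rule for inner automorphisms is pushed through the action;
  \<open>A'\<close> is any matrix representing the coset \<open>h x\<close>.\<close>

lemma PSL_action_normalises:
  fixes G :: "(('a::field ^ 'n ^ 'n) set \<Rightarrow> ('a ^ 'n ^ 'n) set) set"
  assumes G: "subgroup G (AutoGroup PSL)"
    and inner: "inner_automorphism PSL ` carrier PSL \<subseteq> G"
    and act: "group_action ((AutoGroup PSL)\<lparr>carrier := G\<rparr>) X \<phi>"
    and nat: "\<And>A. A \<in> carrier SL \<Longrightarrow> \<phi> (inner_automorphism PSL (SL_scalars #>\<^bsub>SL\<^esub> A)) = pg_action A"
    and h: "h \<in> G" and A: "A \<in> carrier SL"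
  obtains A' where "A' \<in> carrier SL" "\<And>P. P \<in> X \<Longrightarrow> \<phi> h (pg_action A P) = pg_action A' (\<phi> h P)"
proof -
  interpret PSL: group "PSL :: ('a ^ 'n ^ 'n) set monoid"
    by (rule group_PSL)
  interpret act: group_action "(AutoGroup PSL)\<lparr>carrier := G\<rparr>" X \<phi>
    by (rule act)
  have G_auto: "G \<subseteq> auto PSL"
    using subgroup.subset[OF G] by (simp add: AutoGroup_def)
  define x where "x = SL_scalars #>\<^bsub>SL\<^esub> A"
  have x: "x \<in> carrier PSL"
    using A by (auto simp: x_def carrier_PSL)
  have "h x \<in> carrier PSL"
    using h G_auto x by (auto simp: auto_def hom_def)
  then obtain A' where A': "A' \<in> carrier SL" "h x = SL_scalars #>\<^bsub>SL\<^esub> A'"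
    by (auto simp: carrier_PSL)
  have eq: "h \<otimes>\<^bsub>AutoGroup PSL\<^esub> inner_automorphism PSL x = inner_automorphism PSL (h x) \<otimes>\<^bsub>AutoGroup PSL\<^esub> h"
    using PSL.auto_mult_inner_automorphism[of h x] h x G_auto inner by blast
  have mem: "inner_automorphism PSL x \<in> G" "inner_automorphism PSL (h x) \<in> G"
    using inner x \<open>h x \<in> carrier PSL\<close> by auto
  have "\<phi> h (pg_action A P) = pg_action A' (\<phi> h P)" if P: "P \<in> X" for P
  proof -
    have "\<phi> (h \<otimes>\<^bsub>AutoGroup PSL\<^esub> inner_automorphism PSL x) P = \<phi> h (\<phi> (inner_automorphism PSL x) P)"
      using act.composition_rule[OF P, of h "inner_automorphism PSL x"] h mem by simp
    moreover have "\<phi> (inner_automorphism PSL (h x) \<otimes>\<^bsub>AutoGroup PSL\<^esub> h) P = \<phi> (inner_automorphism PSL (h x)) (\<phi> h P)"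
      using act.composition_rule[OF P, of "inner_automorphism PSL (h x)" h] h mem by simp
    ultimately show ?thesis
      using eq nat[OF A] nat[OF A'(1)] A'(2) by (simp add: x_def)
  qed
  then show ?thesis
    using that A'(1) by blast
qed

section \<open>Points of projective space\<close>

lemma span_singleton_in_pg_points: "w \<noteq> 0 \<Longrightarrow> vec.span {w} \<in> pg_points"
  by (simp add: pg_points_def vec.subspace_span)

lemma pg_points_obtain:
  assumes "P \<in> pg_points"
  obtains w where "w \<noteq> 0" "P = vec.span {w}"
proof -
  have P: "vec.subspace P" "vec.dim P = 1"
    using assms by (auto simp: pg_points_def)
  obtain B where B: "B \<subseteq> P" "vec.independent B" "P \<subseteq> vec.span B" "card B = vec.dim P"
    using vec.basis_exists by blast
  then obtain w where w: "B = {w}"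
    using P(2) card_1_singletonE by metis
  have "w \<noteq> 0"
    using B(2) w vec.dependent_zero by blast
  moreover have "P = vec.span {w}"
    using B w P(1) by (metis vec.span_subspace)
  ultimately show ?thesis
    using that by blast
qed

lemma span_singleton_scale:
  fixes w :: "'a::field ^ 'n"
  assumes "c \<noteq> 0"
  shows "vec.span {c *s w} = vec.span {w}"
proof -
  have "k *s w = (k / c) *s (c *s w)" for k
    using assms by (simp add: vector_smult_assoc)
  moreover have "k *s (c *s w) = (k * c) *s w" for k
    by (simp add: vector_smult_assoc)
  ultimately show ?thesis
    unfolding vec.span_singleton by (metis (no_types, lifting) image_subset_iff rangeI subset_antisym)
qed

lemma span_singleton_eqD:
  fixes w :: "'a::field ^ 'n"
  assumes "vec.span {u} = vec.span {w}"
  obtains c where "u = c *s w"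
proof -
  have "u \<in> vec.span {w}"
    using assms vec.span_base[of u "{u}"] by simp
  then show ?thesis
    using that by (auto simp: vec.span_singleton)
qed

lemma pg_action_span:
  fixes A :: "'a::field ^ 'n ^ 'n"
  assumes "w \<noteq> 0"
  shows "pg_action A (vec.span {w}) = vec.span {A *v w}"
proof -
  have "(*v) A ` vec.span {w} = vec.span ((*v) A ` {w})"
    by (rule vec.span_image[symmetric])
  then show ?thesis
    using span_singleton_in_pg_points[OF assms] by (simp add: pg_action_def)
qed

lemma inj_matrix_vector_mult_det:
  fixes A :: "'a::field ^ 'n ^ 'n"
  assumes "det A \<noteq> 0"
  shows "inj ((*v) A)"
  using assms by (simp add: inj_matrix_vector_mult invertible_det_nz)

lemma pg_action_inj:
  fixes A :: "'a::field ^ 'n ^ 'n"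
  assumes "det A \<noteq> 0"
  shows "inj_on (pg_action A) pg_points"
  using inj_matrix_vector_mult_det[OF assms] by (auto simp: inj_on_def pg_action_def inj_image_eq_iff)

section \<open>Projective spaces of dimension at least two\<close>

text \<open>Adding row \<open>k\<close> of the identity matrix to row \<open>m\<close> is a row
  operation that preserves the determinant.\<close>

lemma transvection_matrix:
  fixes k m :: "'n::finite"
  assumes "k \<noteq> m"
  obtains A :: "'a::field ^ 'n ^ 'n" where "det A = 1"
    "\<And>x r. (A *v x) $ r = (if r = m then x $ m + x $ k else x $ r)"
proof -
  define A :: "'a ^ 'n ^ 'n" where "A = (\<chi> r. if r = m then row m (mat 1) + 1 *s row k (mat 1) else row r (mat 1))"
  have "det A = det (mat 1 :: 'a ^ 'n ^ 'n)"
    unfolding A_def using assms by (intro det_row_operation) auto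
  then have "det A = 1"
    by simp
  moreover have "(A *v x) $ r = (if r = m then x $ m + x $ k else x $ r)" for x r
  proof -
    have row1: "(\<Sum>s\<in>UNIV. row r (mat 1) $ s * x $ s) = x $ r" for r
      using arg_cong[OF matrix_vector_mul_lid[of x], of "\<lambda>y. y $ r"]
      by (simp add: matrix_vector_mult_def row_def)
    show ?thesis
      by (simp add: A_def matrix_vector_mult_def distrib_right sum.distrib row1)
  qed
  ultimately show ?thesis
    by (rule that)
qed

lemma diagonal_matrix:
  fixes i j :: "'n::finite" and t :: "'a::field"
  assumes "i \<noteq> j" "t \<noteq> 0"
  obtains A :: "'a ^ 'n ^ 'n" where "det A = 1"
    "\<And>x r. (A *v x) $ r = (if r = i then t else if r = j then 1 / t else 1) * x $ r"
proof -
  define \<delta> where "\<delta> r = (if r = i then t else if r = j then 1 / t else 1)" for r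
  define A :: "'a ^ 'n ^ 'n" where "A = (\<chi> r s. if r = s then \<delta> r else 0)"
  have "det A = (\<Prod>r\<in>UNIV. \<delta> r)"
    unfolding A_def by (subst det_diagonal) auto
  also have "\<dots> = (\<Prod>r\<in>{i, j}. \<delta> r)"
    by (rule prod.mono_neutral_right) (auto simp: \<delta>_def)
  also have "\<dots> = 1"
    using assms by (simp add: \<delta>_def)
  finally have "det A = 1" .
  moreover have "(A *v x) $ r = \<delta> r * x $ r" for x r
    unfolding A_def matrix_vector_mult_def
    by (simp add: if_distrib if_distribR cong: if_cong)
  ultimately show ?thesis
    using that[of A] by (simp add: \<delta>_def)
qed

lemma no_SL_invariant_sqs:
  fixes B :: "('a::field ^ 'n) set set set"
  assumes n: "CARD('n) > 2"
    and S: "steiner_quadruple_system v pg_points B"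
    and inv: "\<And>A :: 'a ^ 'n ^ 'n. det A = 1 \<Longrightarrow> \<forall>b\<in>B. pg_action A ` b \<in> B"
  shows False
proof -
  define e where "e m = (axis m 1 :: 'a ^ 'n)" for m
  define p where "p w = vec.span {w}" for w :: "'a ^ 'n"
  have e_nth: "e m $ r = (if r = m then 1 else 0)" for m r
    by (simp add: e_def axis_def)
  have e0: "e m \<noteq> 0" for m
    by (metis e_nth zero_index zero_neq_one)
  have p_ne: "p u \<noteq> p w" if "u $ r \<noteq> 0" "w $ r = 0" for u w r
  proof
    assume "p u = p w"
    then obtain c where "u = c *s w"
      unfolding p_def by (rule span_singleton_eqD)
    then show False
      using that by simp
  qed
  \<comment> \<open>A matrix fixing the points of a triple fixes the fourth point of its block, so a
    vector spanning that point is an eigenvector.\<close>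
  have eigen: "\<exists>c. A *v w = c *s w"
    if A: "det A = 1" and T: "T \<subseteq> pg_points" "card T = 3" "\<And>P. P \<in> T \<Longrightarrow> pg_action A P = P"
      and w: "w \<noteq> 0" "p w \<notin> T" "insert (p w) T \<in> B" for A T w
  proof -
    have "pg_action A (p w) = p w"
    proof (rule sqs_fourth_point_fixed[OF S T(1,2) w(2,3)])
      show "inj_on (pg_action A) pg_points"
        using A by (intro pg_action_inj) simp
      show "pg_action A ` T = T"
        using T(3) by simp
      show "pg_action A ` insert (p w) T \<in> B"
        using inv[OF A] w(3) by blast
    qed
    then have "vec.span {A *v w} = vec.span {w}"
      using pg_action_span[OF w(1)] by (simp add: p_def)
    then show ?thesis
      by (metis span_singleton_eqD)
  qed
  obtain a b c :: 'n where abc: "a \<noteq> b" "a \<noteq> c" "b \<noteq> c"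
  proof -
    obtain T :: "'n set" where "card T = 3"
      using obtain_subset_with_card_n[of 3 "UNIV :: 'n set"] n by auto
    then show ?thesis
      using that by (auto simp: card_3_iff)
  qed
  show False
  proof (cases "\<exists>t::'a. t \<noteq> 0 \<and> t \<noteq> 1")
    case True
    then obtain t :: 'a where t: "t \<noteq> 0" "t \<noteq> 1" by blast
    let ?T = "{p (e a), p (e b), p (e c)}"
    have "p (e i) \<noteq> p (e j)" if "i \<noteq> j" for i j
      using that by (intro p_ne[of _ i]) (auto simp: e_nth)
    then have T: "?T \<subseteq> pg_points" "card ?T = 3"
      using abc span_singleton_in_pg_points[OF e0] by (auto simp: p_def)
    obtain P where P: "P \<in> pg_points" "P \<notin> ?T" "insert P ?T \<in> B"
      using sqs_block_exists[OF S T] .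
    obtain w where w: "w \<noteq> 0" "P = p w"
      using pg_points_obtain[OF P(1)] unfolding p_def by blast
    have unique: "w $ k = 0" if ik: "w $ i \<noteq> 0" "k \<noteq> i" for i k
    proof (rule ccontr)
      assume k: "w $ k \<noteq> 0"
      \<comment> \<open>A third coordinate \<open>j\<close> absorbs the factor 1/t, so coordinate
        \<open>i\<close> can be scaled by \<open>t\<close> while coordinate \<open>k\<close> stays.
        An eigenvector cannot be nonzero in both.\<close>
      have "card {i, k} < CARD('n)"
        using n ik(2) by simp
      then obtain j where j: "j \<noteq> i" "j \<noteq> k"
        by (metis (mono_tags, lifting) UNIV_eq_I insertCI less_irrefl)
      obtain A :: "'a ^ 'n ^ 'n" where A: "det A = 1"
        "\<And>x r. (A *v x) $ r = (if r = i then t else if r = j then 1 / t else 1) * x $ r"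
        using diagonal_matrix[of i j t] j t by metis
      have "A *v e m = (if m = i then t else if m = j then 1 / t else 1) *s e m" for m
        by (simp add: vec_eq_iff A(2) e_nth)
      then have "pg_action A (p (e m)) = p (e m)" for m
        unfolding p_def using t by (simp add: pg_action_span[OF e0] span_singleton_scale)
      then obtain d where d: "A *v w = d *s w"
        using eigen[OF A(1) T _ w(1)] P w(2) by blast
      have "d * w $ i = t * w $ i" "d * w $ k = 1 * w $ k"
        using A(2)[of w i] A(2)[of w k] j ik(2) by (simp_all add: d)
      then show False
        using ik(1) k t(2) by (metis mult_right_cancel)
    qed
    obtain m where m: "w $ m \<noteq> 0"
      using w(1) by (metis vec_eq_iff zero_index)
    have "w = (w $ m) *s e m"
      using unique[OF m] by (simp add: vec_eq_iff e_nth)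
    then have "P = p (e m)"
      using w(2) span_singleton_scale[OF m] unfolding p_def by metis
    then have m_abc: "m \<noteq> a" "m \<noteq> b" "m \<noteq> c"
      using P(2) by auto
    \<comment> \<open>Adding coordinate \<open>m\<close> to coordinate \<open>a\<close> fixes the
      three chosen coordinate vectors but moves the point of \<open>e m\<close>.\<close>
    obtain A :: "'a ^ 'n ^ 'n" where A: "det A = 1"
      "\<And>x r. (A *v x) $ r = (if r = a then x $ a + x $ m else x $ r)"
      using transvection_matrix[of m a] m_abc by metis
    have "A *v e r = e r" if "r \<noteq> m" for r
      using that by (auto simp: vec_eq_iff A(2) e_nth)
    then have "pg_action A Q = Q" if "Q \<in> ?T" for Q
      using that m_abc unfolding p_def by (auto simp: pg_action_span[OF e0])
    then obtain d where d: "A *v w = d *s w"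
      using eigen[OF A(1) T _ w(1)] P w(2) by blast
    have "w $ a = 0"
      using unique[OF m] m_abc by simp
    then show False
      using A(2)[of w a] m by (simp add: d)
  next
    case False
    then have two: "x = 0 \<or> x = 1" for x :: 'a by blast
    \<comment> \<open>Over two elements the diagonal matrices are useless, so the triple is a full
      projective line instead.\<close>
    let ?T = "{p (e a), p (e b), p (e a + e b)}"
    have "p (e a) \<noteq> p (e b)" "p (e a + e b) \<noteq> p (e b)" "p (e a + e b) \<noteq> p (e a)"
      using abc p_ne[of "e a" a "e b"] p_ne[of "e a + e b" a "e b"] p_ne[of "e a + e b" b "e a"]
      by (simp_all add: e_nth)
    moreover have ab0: "e a + e b \<noteq> 0"
      using abc by (metis add.right_neutral e_nth vector_add_component zero_index zero_neq_one)
    ultimately have T: "?T \<subseteq> pg_points" "card ?T = 3"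
      using span_singleton_in_pg_points[OF e0] span_singleton_in_pg_points[OF ab0]
      by (auto simp: p_def)
    obtain P where P: "P \<in> pg_points" "P \<notin> ?T" "insert P ?T \<in> B"
      using sqs_block_exists[OF S T] .
    obtain w where w: "w \<noteq> 0" "P = p w"
      using pg_points_obtain[OF P(1)] unfolding p_def by blast
    have wk: "w $ k = 0" if k: "k \<noteq> a" "k \<noteq> b" for k
    proof (rule ccontr)
      assume wk: "w $ k \<noteq> 0"
      \<comment> \<open>This transvection is the identity on vectors with zero coordinate
        \<open>k\<close>, so it fixes the line pointwise, yet \<open>w\<close> is no eigenvector of
        it.\<close>
      obtain A :: "'a ^ 'n ^ 'n" where A: "det A = 1"
        "\<And>x r. (A *v x) $ r = (if r = a then x $ a + x $ k else x $ r)"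
        using transvection_matrix[of k a] k by metis
      have fixed: "A *v x = x" if "x $ k = 0" for x
        using that by (auto simp: vec_eq_iff A(2))
      then have "A *v e a = e a" "A *v e b = e b" "A *v (e a + e b) = e a + e b"
        using k by (auto simp: e_nth intro!: fixed)
      then have "pg_action A Q = Q" if "Q \<in> ?T" for Q
        using that unfolding p_def by (auto simp: pg_action_span[OF e0] pg_action_span[OF ab0])
      then obtain d where d: "A *v w = d *s w"
        using eigen[OF A(1) T _ w(1)] P w(2) by blast
      have "d * w $ k = w $ k"
        using A(2)[of w k] k by (simp add: d)
      then have "d = 1"
        using wk by simp
      then show False
        using A(2)[of w a] wk by (simp add: d)
    qed
    \<comment> \<open>The fourth point would lie on the line, all of whose points are already in the
      triple.\<close>
    have "w = w $ a *s e a + w $ b *s e b"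
      using wk abc(1) by (auto simp: vec_eq_iff e_nth)
    then have "w = e a \<or> w = e b \<or> w = e a + e b"
      using two[of "w $ a"] two[of "w $ b"] w(1)
      by (metis add.left_neutral add.right_neutral vector_smult_lid vector_smult_lzero)
    then show False
      using P(2) w(2) by blast
  qed
qed

section \<open>Coordinates on the projective line\<close>

text \<open>Homogeneous coordinates for a two-element index type: the entry at \<open>i\<close> is
  the numerator, the other one the denominator, and infinity is (1 : 0).\<close>

definition line_vector :: "'n::finite \<Rightarrow> 'a::field option \<Rightarrow> 'a ^ 'n" where
  "line_vector i z = (case z of None \<Rightarrow> axis i 1 | Some x \<Rightarrow> (\<chi> k. if k = i then x else 1))"

definition line_point :: "'n::finite \<Rightarrow> 'a::field option \<Rightarrow> ('a ^ 'n) set" where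
  "line_point i z = vec.span {line_vector i z}"

lemma det_2_indices:
  fixes A :: "'a::comm_ring_1 ^ 'n ^ 'n"
  assumes ij: "i \<noteq> j" "UNIV = {i, j}"
  shows "det A = A $ i $ i * A $ j $ j - A $ i $ j * A $ j $ i"
proof -
  have f: "finite {j}" "i \<notin> {j}"
    using ij(1) by auto
  show ?thesis
    unfolding det_def ij(2) unfolding sum_over_permutations_insert[OF f] permutes_sing
    using ij(1) by (simp add: sign_swap_id sign_id swap_id_eq)
qed

context
  fixes i j :: "'n::finite"
  assumes ij: "i \<noteq> j" "UNIV = {i, j}"
begin

lemma index_cases: "k = i \<or> k = j"
  using ij(2) by blast

lemma line_vector_nth:
  "line_vector i z $ i = (case z of None \<Rightarrow> 1 | Some x \<Rightarrow> x)"
  "line_vector i z $ j = (case z of None \<Rightarrow> 0 | Some x \<Rightarrow> 1)"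
  using ij(1) by (auto simp: line_vector_def axis_def split: option.split)

lemma vec_eq_2: "(x = (y :: 'b ^ 'n)) \<longleftrightarrow> x $ i = y $ i \<and> x $ j = y $ j"
  unfolding vec_eq_iff by (metis index_cases)

lemma line_vector_nonzero: "line_vector i z \<noteq> 0"
  by (cases z) (auto simp: vec_eq_2 line_vector_nth)

lemma line_vector_normalise:
  fixes w :: "'a::field ^ 'n"
  assumes "w \<noteq> 0"
  obtains c where "c \<noteq> 0"
    "w = c *s line_vector i (if w $ j = 0 then None else Some (w $ i / w $ j))"
proof (cases "w $ j = 0")
  case True
  then show ?thesis
    using assms by (intro that[of "w $ i"]) (auto simp: vec_eq_2 line_vector_nth)
next
  case False
  then show ?thesis
    by (intro that[of "w $ j"]) (auto simp: vec_eq_2 line_vector_nth)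
qed

lemma bij_betw_line_point: "bij_betw (line_point i) UNIV (pg_points :: ('a::field ^ 'n) set set)"
proof (rule bij_betw_imageI)
  show "inj (line_point i :: 'a option \<Rightarrow> _)"
  proof (rule injI)
    fix z z' :: "'a option"
    assume "line_point i z = line_point i z'"
    then obtain c where "line_vector i z = c *s line_vector i z'"
      unfolding line_point_def by (rule span_singleton_eqD)
    then show "z = z'"
      by (cases z; cases z') (auto simp: vec_eq_2 line_vector_nth)
  qed
  show "range (line_point i) = (pg_points :: ('a ^ 'n) set set)"
  proof
    show "range (line_point i) \<subseteq> (pg_points :: ('a ^ 'n) set set)"
      unfolding line_point_def using span_singleton_in_pg_points[OF line_vector_nonzero] by blast
    show "(pg_points :: ('a ^ 'n) set set) \<subseteq> range (line_point i)"
    proof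
      fix P :: "('a ^ 'n) set"
      assume "P \<in> pg_points"
      then obtain w where w: "w \<noteq> 0" "P = vec.span {w}"
        by (rule pg_points_obtain)
      obtain c where "c \<noteq> 0" "w = c *s line_vector i (if w $ j = 0 then None else Some (w $ i / w $ j))"
        using line_vector_normalise[OF w(1)] .
      then have "P = line_point i (if w $ j = 0 then None else Some (w $ i / w $ j))"
        using w(2) span_singleton_scale unfolding line_point_def by metis
      then show "P \<in> range (line_point i)"
        by blast
    qed
  qed
qed

text \<open>Normalising the image vector leaves the quotient of its two entries, which is the
  fractional linear formula; a zero denominator gives infinity.\<close>

lemma pg_action_line_point:
  fixes A :: "'a::field ^ 'n ^ 'n"
  assumes "det A \<noteq> 0"
  shows "pg_action A (line_point i z) =
    line_point i (moebius (A $ i $ i) (A $ i $ j) (A $ j $ i) (A $ j $ j) z)"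
proof -
  let ?w = "A *v line_vector i z"
  have comp: "(A *v x) $ k = A $ k $ i * x $ i + A $ k $ j * x $ j" for x k
    using ij(1) by (simp add: matrix_vector_mult_def ij(2))
  have "?w \<noteq> 0"
    using inj_matrix_vector_mult_det[OF assms] line_vector_nonzero
    by (metis injD matrix_vector_mult_0_right)
  then obtain c where "c \<noteq> 0" "?w = c *s line_vector i (if ?w $ j = 0 then None else Some (?w $ i / ?w $ j))"
    by (rule line_vector_normalise)
  then have "vec.span {?w} = line_point i (if ?w $ j = 0 then None else Some (?w $ i / ?w $ j))"
    using span_singleton_scale unfolding line_point_def by metis
  also have "(if ?w $ j = 0 then None else Some (?w $ i / ?w $ j)) =
      moebius (A $ i $ i) (A $ i $ j) (A $ j $ i) (A $ j $ j) z"
    by (cases z) (simp_all add: comp line_vector_nth)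
  finally show ?thesis
    using pg_action_span[OF line_vector_nonzero] unfolding line_point_def by metis
qed

lemma SL_to_L2:
  fixes A :: "'a::field ^ 'n ^ 'n"
  assumes "det A = 1"
  obtains g where "g \<in> L2_line" "\<And>z. pg_action A (line_point i z) = line_point i (g z)"
proof -
  have "A $ i $ i * A $ j $ j - A $ i $ j * A $ j $ i = 1"
    using det_2_indices[OF ij, of A] assms by simp
  then have "moebius (A $ i $ i) (A $ i $ j) (A $ j $ i) (A $ j $ j) \<in> L2_line"
    unfolding L2_line_def by blast
  then show ?thesis
    using pg_action_line_point[of A] assms by (intro that) simp_all
qed

lemma L2_to_SL:
  assumes "g \<in> L2_line"
  obtains A :: "'a::field ^ 'n ^ 'n" where "det A = 1" "\<And>z. pg_action A (line_point i z) = line_point i (g z)"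
proof -
  obtain a b c d where g: "g = moebius a b c d" "a * d - b * c = 1"
    using assms by (auto simp: L2_line_def)
  define A :: "'a ^ 'n ^ 'n" where
    "A = (\<chi> r s. if r = i then if s = i then a else b else if s = i then c else d)"
  have A: "A $ i $ i = a" "A $ i $ j = b" "A $ j $ i = c" "A $ j $ j = d"
    using ij(1) by (auto simp: A_def)
  have "det A = 1"
    using det_2_indices[OF ij, of A] A g(2) by simp
  then show ?thesis
    using pg_action_line_point[of A] A g(1) by (intro that[of A]) simp_all
qed

end

section \<open>Transport between projective space and the projective line\<close>

text \<open>The chart \<open>f\<close> carries the design and the permutation group to the line,
  where the hypotheses of \<open>classified_if_automorphisms\<close> are checked one by one.\<close>

lemma automorphisms_imp_classified:
  fixes G :: "(('a::{field,finite} ^ 'n::finite ^ 'n) set \<Rightarrow> ('a ^ 'n ^ 'n) set) set"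
  assumes n: "CARD('n) = 2" and q: "CARD('a) \<noteq> 3"
    and G: "subgroup G (AutoGroup PSL)"
    and inner: "inner_automorphism PSL ` carrier PSL \<subseteq> G"
    and act: "group_action ((AutoGroup PSL)\<lparr>carrier := G\<rparr>) pg_points \<phi>"
    and nat: "\<And>A. A \<in> carrier SL \<Longrightarrow> \<phi> (inner_automorphism PSL (SL_scalars #>\<^bsub>SL\<^esub> A)) = pg_action A"
    and S: "steiner_quadruple_system v pg_points B"
    and aut: "\<phi> ` G \<subseteq> design_automorphisms pg_points B"
  obtains C :: "'a option set set" and K where
    "design_group_isomorphic pg_points B (\<phi> ` G) UNIV C K" "classified C K"
proof -
  obtain i j :: 'n where ij: "i \<noteq> j" "UNIV = {i, j}"
    using n by (auto simp: card_2_iff)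
  define pt :: "'a option \<Rightarrow> ('a ^ 'n) set" where "pt = line_point i"
  have pt: "bij_betw pt UNIV pg_points"
    unfolding pt_def by (rule bij_betw_line_point[OF ij])
  define f where "f = inv_into UNIV pt"
  have f: "bij_betw f pg_points UNIV"
    unfolding f_def using pt by (rule bij_betw_inv_into)
  have f_pt: "f (pt z) = z" for z
    unfolding f_def using pt by (simp add: bij_betw_def)
  have pt_f: "pt (f P) = P" if "P \<in> pg_points" for P
    unfolding f_def using pt that by (metis bij_betw_inv_into_right)
  have pt_in: "pt z \<in> pg_points" for z
    using pt by (auto simp: bij_betw_def)
  have inv_f: "inv_into pg_points f z = pt z" for z
    using f pt_in f_pt by (metis bij_betw_inv_into_left)
  define C where "C = (`) f ` B"
  define conj where "conj h z = f (h (pt z))" for h :: "('a ^ 'n) set \<Rightarrow> ('a ^ 'n) set" and z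
  define K where "K = conj ` \<phi> ` G"
  \<comment> \<open>The restriction in the notion of isomorphism is void here because the target
    point set is the whole type.\<close>
  have "(\<lambda>h. \<lambda>y\<in>UNIV. f (h (inv_into pg_points f y))) = conj"
    by (intro ext) (simp add: conj_def inv_f)
  then have "design_group_isomorphic pg_points B (\<phi> ` G) UNIV C K"
    unfolding design_group_isomorphic_def C_def K_def using f by blast
  moreover have "classified C K"
  proof (rule classified_if_automorphisms[OF q])
    show "steiner_quadruple_system v UNIV C"
      unfolding C_def by (rule sqs_transport[OF f S])
    have h_bij: "bij_betw h pg_points pg_points" if "h \<in> \<phi> ` G" for h
      using aut that by (auto simp: design_automorphisms_def Bij_def)
    have conj_pt: "pt (conj h z) = h (pt z)" if "h \<in> \<phi> ` G" for h z
      unfolding conj_def using h_bij[OF that] pt_in by (metis bij_betwE pt_f)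
    show "L2_line \<subseteq> K"
    proof
      fix g :: "'a option \<Rightarrow> 'a option"
      assume "g \<in> L2_line"
      then obtain A :: "'a ^ 'n ^ 'n" where A: "det A = 1" "\<And>z. pg_action A (pt z) = pt (g z)"
        unfolding pt_def using L2_to_SL[OF ij] by blast
      have SL: "A \<in> carrier SL"
        using A(1) by (simp add: SL_simps)
      then have "inner_automorphism PSL (SL_scalars #>\<^bsub>SL\<^esub> A) \<in> G"
        using inner by (auto simp: carrier_PSL)
      then have "pg_action A \<in> \<phi> ` G"
        using nat[OF SL] by (metis imageI)
      moreover have "g = conj (pg_action A)"
        by (rule ext) (simp add: conj_def A(2) f_pt)
      ultimately show "g \<in> K"
        unfolding K_def by blast
    qed
    show "preserves_blocks K C"
      unfolding preserves_blocks_def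
    proof (intro ballI)
      fix k b assume "k \<in> K" "b \<in> C"
      then obtain h c where h: "h \<in> \<phi> ` G" "k = conj h" and c: "c \<in> B" "b = f ` c"
        unfolding K_def C_def by blast
      have "c \<subseteq> pg_points"
        using S c(1) by (auto simp: steiner_quadruple_system_def)
      then have "k (f x) = f (h x)" if "x \<in> c" for x
        using that by (simp add: h(2) conj_def pt_f subset_iff)
      then have "k ` b = f ` h ` c"
        by (simp add: c(2) image_image)
      moreover have "h ` c \<in> B"
        using aut h(1) c(1) by (auto simp: design_automorphisms_def)
      ultimately show "k ` b \<in> C"
        unfolding C_def by blast
    qed
    show "bij k" if k: "k \<in> K" for k
    proof -
      obtain h where h: "h \<in> \<phi> ` G" "k = conj h"
        using k unfolding K_def by blast
      have "k = f \<circ> (h \<circ> pt)"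
        by (rule ext) (simp add: h(2) conj_def)
      then show ?thesis
        using bij_betw_trans[OF bij_betw_trans[OF pt h_bij[OF h(1)]] f] by simp
    qed
    \<comment> \<open>Automorphisms of the abstract group permute its inner automorphisms; in
      coordinates this says that \<open>k\<close> normalises \<open>L2_line\<close>.\<close>
    show "\<exists>g'\<in>L2_line. k \<circ> g = g' \<circ> k" if "k \<in> K" and g: "g \<in> L2_line" for k g
    proof -
      obtain h where h: "h \<in> G" "k = conj (\<phi> h)"
        using \<open>k \<in> K\<close> unfolding K_def by blast
      obtain A :: "'a ^ 'n ^ 'n" where A: "det A = 1" "\<And>z. pg_action A (pt z) = pt (g z)"
        using g unfolding pt_def using L2_to_SL[OF ij] by blast
      have "A \<in> carrier SL"
        using A(1) by (simp add: SL_simps)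
      then obtain A' where A': "A' \<in> carrier SL"
        "\<And>P. P \<in> pg_points \<Longrightarrow> \<phi> h (pg_action A P) = pg_action A' (\<phi> h P)"
        using PSL_action_normalises[OF G inner act nat h(1)] by blast
      have "det A' = 1"
        using A'(1) by (simp add: SL_simps)
      then obtain g' where g': "g' \<in> L2_line" "\<And>z. pg_action A' (pt z) = pt (g' z)"
        unfolding pt_def using SL_to_L2[OF ij] by blast
      have "k (g z) = g' (k z)" for z
      proof -
        have "\<phi> h (pt (g z)) = pg_action A' (\<phi> h (pt z))"
          using A'(2)[OF pt_in] A(2) by simp
        also have "\<dots> = pt (g' (k z))"
          using conj_pt[OF imageI[OF h(1)], of z] g'(2)[of "k z"] h(2) by metis
        finally have "\<phi> h (pt (g z)) = pt (g' (k z))" .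
        then show ?thesis
          by (simp add: h(2) conj_def f_pt)
      qed
      then have "k \<circ> g = g' \<circ> k"
        by (intro ext) simp
      then show ?thesis
        using g'(1) by blast
    qed
  qed
  ultimately show ?thesis
    by (rule that)
qed

text \<open>The conjugate of \<open>h\<close> on the line preserves blocks, and injectivity of the
  isomorphism on \<open>X\<close> pulls this back to \<open>h\<close>.\<close>

lemma automorphisms_if_isomorphic_classified:
  fixes C :: "'a::{field,finite} option set set"
  assumes iso: "design_group_isomorphic X B H UNIV C K" and K: "classified C K"
    and S: "steiner_quadruple_system v X B" and H: "H \<subseteq> Bij X"
  shows "H \<subseteq> design_automorphisms X B"
proof
  fix h assume h: "h \<in> H"
  obtain f where f: "bij_betw f X UNIV" "(\<lambda>b. f ` b) ` B = C"
    "(\<lambda>h. \<lambda>y\<in>UNIV. f (h (inv_into X f y))) ` H = K"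
    using iso unfolding design_group_isomorphic_def by blast
  have hX: "h ` X = X"
    using H h by (auto simp: Bij_def bij_betw_def)
  have inj: "inj_on f X"
    using f(1) by (simp add: bij_betw_def)
  have SC: "steiner_quadruple_system v UNIV C"
    using sqs_transport[OF f(1) S] f(2) by simp
  define k where "k = (\<lambda>y\<in>UNIV. f (h (inv_into X f y)))"
  have "k \<in> K"
    using f(3) h unfolding k_def by blast
  have "h ` b \<in> B" if b: "b \<in> B" for b
  proof -
    have bX: "b \<subseteq> X"
      using S b by (auto simp: steiner_quadruple_system_def)
    have "k ` f ` b \<in> C"
      using preserves_blocksD[OF automorphisms_if_classified[OF SC K] \<open>k \<in> K\<close>] b f(2) by blast
    moreover have "k (f x) = f (h x)" if "x \<in> b" for x
      using that bX inj by (simp add: k_def subset_iff)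
    then have "k ` f ` b = f ` h ` b"
      by (simp add: image_image)
    ultimately have "f ` h ` b \<in> (\<lambda>b. f ` b) ` B"
      unfolding f(2) by simp
    then obtain b' where b': "b' \<in> B" "f ` h ` b = f ` b'"
      by (rule imageE)
    have "b' \<subseteq> X"
      using S b'(1) by (auto simp: steiner_quadruple_system_def)
    moreover have "h ` b \<subseteq> X"
      using bX hX by blast
    ultimately have "h ` b = b'"
      using b'(2) inj by (simp add: inj_on_image_eq_iff)
    then show ?thesis
      using b'(1) by simp
  qed
  then show "h \<in> design_automorphisms X B"
    using H h by (auto simp: design_automorphisms_def)
qed

theorem mainTheorem1:
  fixes n q v :: nat
    and G :: "(('a::{field,finite} ^ 'n::finite ^ 'n) set \<Rightarrow> ('a ^ 'n ^ 'n) set) set"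
    and \<phi> :: "(('a ^ 'n ^ 'n) set \<Rightarrow> ('a ^ 'n ^ 'n) set) \<Rightarrow> ('a ^ 'n) set \<Rightarrow> ('a ^ 'n) set"
    and X :: "('a ^ 'n) set set"
  assumes n: "n = CARD('n)" and q: "q = CARD('a)"
    and "n \<ge> 2" and "(n, q) \<notin> {(2, 2), (2, 3)}"
    and v: "v = (q ^ n - 1) div (q - 1)"
    and X: "X = pg_points"
    and "subgroup G (AutoGroup PSL)"
    and "inner_automorphism PSL ` carrier PSL \<subseteq> G"
    and "group_action ((AutoGroup PSL)\<lparr>carrier := G\<rparr>) X \<phi>"
    and "\<And>A. A \<in> carrier SL \<Longrightarrow>
           \<phi> (inner_automorphism PSL (SL_scalars #>\<^bsub>SL\<^esub> A)) = pg_action A"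
  shows "(\<forall>\<B>. nontrivial_sqs v X \<B> \<longrightarrow>
           (\<phi> ` G \<subseteq> design_automorphisms X \<B> \<longleftrightarrow>
            n = 2 \<and>
            (\<exists>(\<C> :: 'a option set set) K.
               design_group_isomorphic X \<B> (\<phi> ` G) UNIV \<C> K \<and>
               ((\<exists>d. q = 3 ^ d \<and>
                     (d \<ge> 2 \<and> \<C> = images_under PGL2_line (insert None (Some ` prime_subfield)) \<or>
                      d > 1 \<and> odd d \<and> \<C> = images_under L2_line (insert None (Some ` prime_subfield))) \<and>
                     L2_line \<subseteq> K \<and> K \<subseteq> PGammaL2_line)
                \<or>
                (q mod 12 = 7 \<and>
                 (\<exists>\<epsilon>. primitive_root_of_unity 6 \<epsilon> \<and>
                      \<C> = images_under L2_line {Some 0, Some 1, None, Some \<epsilon>}) \<and>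
                 L2_line \<subseteq> K \<and> K \<subseteq> PSigmaL2_line)
                \<or>
                (\<exists>d. d \<ge> 1 \<and> q = 3 ^ (2 * d) \<and>
                     (\<exists>a. a \<noteq> 0 \<and> (\<nexists>b. a = b ^ 2) \<and>
                          images_under L2_line {Some 0, Some 1, Some (- 1), None} \<inter>
                            images_under L2_line {Some 0, Some 1, Some a, None} = {} \<and>
                          \<C> = images_under L2_line {Some 0, Some 1, Some (- 1), None} \<union>
                            images_under L2_line {Some 0, Some 1, Some a, None}) \<and>
                     L2_line \<subseteq> K \<and> K \<subseteq> PSigmaL2_line)))))
         \<and> (n > 2 \<longrightarrow>
             \<not> (\<exists>\<B>. steiner_quadruple_system v X \<B> \<and> \<phi> ` G \<subseteq> design_automorphisms X \<B>))"
proof -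
  have act: "group_action ((AutoGroup PSL)\<lparr>carrier := G\<rparr>) pg_points \<phi>"
    using assms(9) X by simp
  have Bij: "\<phi> ` G \<subseteq> Bij X"
    using group_action.bij_prop0[OF assms(9)] by auto
  \<comment> \<open>The inner automorphisms lie in \<open>G\<close> and act naturally, so every
    matrix of determinant 1 preserves the blocks.\<close>
  have SL_aut: "\<forall>b\<in>\<B>. pg_action A ` b \<in> \<B>"
    if "\<phi> ` G \<subseteq> design_automorphisms X \<B>" "det A = 1" for \<B> and A :: "'a ^ 'n ^ 'n"
  proof -
    have SL: "A \<in> carrier SL"
      using that(2) by (simp add: SL_simps)
    then have "inner_automorphism PSL (SL_scalars #>\<^bsub>SL\<^esub> A) \<in> G"
      using assms(8) by (auto simp: carrier_PSL)
    then have "pg_action A \<in> \<phi> ` G"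
      using assms(10)[OF SL] by (metis imageI)
    then show ?thesis
      using that(1) by (auto simp: design_automorphisms_def)
  qed
  \<comment> \<open>This gives both the final clause and the reduction of the equivalence to n =
    2.\<close>
  have big: "\<not> \<phi> ` G \<subseteq> design_automorphisms X \<B>"
    if "n > 2" "steiner_quadruple_system v X \<B>" for \<B>
    using no_SL_invariant_sqs[of v \<B>] SL_aut that n X by blast
  have "\<phi> ` G \<subseteq> design_automorphisms X \<B> \<longleftrightarrow>
      n = 2 \<and> (\<exists>(\<C> :: 'a option set set) K.
        design_group_isomorphic X \<B> (\<phi> ` G) UNIV \<C> K \<and> classified \<C> K)"
    if "nontrivial_sqs v X \<B>" for \<B>
  proof
    have S: "steiner_quadruple_system v X \<B>"
      using that by (simp add: nontrivial_sqs_def)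
    show "\<phi> ` G \<subseteq> design_automorphisms X \<B>" if "n = 2 \<and> (\<exists>(\<C> :: 'a option set set) K.
        design_group_isomorphic X \<B> (\<phi> ` G) UNIV \<C> K \<and> classified \<C> K)"
      using that automorphisms_if_isomorphic_classified[OF _ _ S Bij] by blast
    assume aut: "\<phi> ` G \<subseteq> design_automorphisms X \<B>"
    then have "n = 2"
      using big[OF _ S] \<open>n \<ge> 2\<close> by linarith
    \<comment> \<open>The excluded pair (2, 3) rules out the field of three elements.\<close>
    then have "CARD('n) = 2" "CARD('a) \<noteq> 3"
      using n q assms(4) by auto
    then obtain \<C> :: "'a option set set" and K where
      "design_group_isomorphic pg_points \<B> (\<phi> ` G) UNIV \<C> K" "classified \<C> K"
      by (rule automorphisms_imp_classified[OF _ _ assms(7,8) act assms(10) S[unfolded X] aut[unfolded X]])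
    then show "n = 2 \<and> (\<exists>(\<C> :: 'a option set set) K.
        design_group_isomorphic X \<B> (\<phi> ` G) UNIV \<C> K \<and> classified \<C> K)"
      using \<open>n = 2\<close> X by blast
  qed
  then show ?thesis
    using big unfolding classified_def q[symmetric] by blast
qed

end
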